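(* Let $d\le n-1$ be a positive integer and let $f:\mathbb N\to\mathbb N$ satisfy $f(n)=\omega(\sqrt n)$. Let $\mathcal D_d=\mathcal D_d(n)$ be the family of $n$-vertex simple graphs on $[n]$ with minimum degree at least $d$. (i) If $d$ is even and $k=d/2$, then $\tau(\mathcal D_d,n)=kn$. (ii) If $d$ is odd and $k=(d-1)/2$, then with high probability $$\left(k+1-1/e\right)n-f(n)\le \tau(\mathcal D_d,n)\le \left(k+1-1/e\right)n+f(n)+2k,$$ where the upper bound is claimed under the additional assumption $d=o(n)$.
   Context: Semi-random no-replacement multigraph process on $[n]=\{1,\dots,n\}$: let $\pi_1,\pi_2,\dots$ be independent uniformly random permutations in $S_n$. Builder's multigraph starts empty on $[n]$. In round $k\ge1$ Builder is offered the vertex $v_k:=\pi_{\lceil k/n\rceil}(k-\lfloor (k-1)/n\rfloor n)$ (so the vertices are offered in blocks of $n$ rounds, block $j$ in the order given by $\pi_j$); Builder then chooses a vertex $u_k$ according to his strategy (a rule depending on the history so far) and adds the edge $u_kv_k$ to his multigraph (multiple edges allowed). For a family $\mathcal F$ of labeled graphs on $[n]$ and a strategy $\mathcal S$, $\tau(\mathcal S)$ is the least $m$ such that Builder's multigraph after $m$ rounds contains some member of $\mathcal F$ as a subgraph ($+\infty$ if none). $\tau_{\text{lab}}(\mathcal F,n)$ is a random variable with $\Pr(\tau_{\text{lab}}(\mathcal F,n)\le k)=\max_{\mathcal S}\Pr(\tau(\mathcal S)\le k)$ for every integer $k\ge0$, and $\tau(\mathcal F,n):=\tau_{\text{lab}}(\mathcal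 F_{\text{iso}},n)$ where $\mathcal F_{\text{iso}}$ is the family of all labeled graphs on $[n]$ isomorphic to a member of $\mathcal F$ (here $\mathcal D_d$ is closed under isomorphism so the two coincide). With high probability (w.h.p.) means with probability tending to $1$ as $n\to\infty$. *)

theory Defs
  imports "HOL-Probability.Probability"
begin

text \<open>A labelled simple graph on \<open>{1..n}\<close> is represented by its edge set.\<close>

type_synonym graph = "nat set set"

definition simple_graph :: "nat \<Rightarrow> graph \<Rightarrow> bool" where
  "simple_graph n E \<longleftrightarrow> (\<forall>e\<in>E. e \<subseteq> {1..n} \<and> card e = 2)"

definition vertex_degree :: "graph \<Rightarrow> nat \<Rightarrow> nat" where
  "vertex_degree E v = card {e \<in> E. v \<in> e}"

definition min_degree :: "nat \<Rightarrow> graph \<Rightarrow> nat" where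
  "min_degree n E = Min (vertex_degree E ` {1..n})"

definition min_degree_family :: "nat \<Rightarrow> nat \<Rightarrow> graph set" where
  "min_degree_family d n = {E. simple_graph n E \<and> d \<le> min_degree n E}"

definition iso_closure :: "nat \<Rightarrow> graph set \<Rightarrow> graph set" where
  "iso_closure n F =
     {E. simple_graph n E \<and> (\<exists>H\<in>F. \<exists>\<phi>. bij_betw \<phi> {1..n} {1..n} \<and> E = (\<lambda>e. \<phi> ` e) ` H)}"

text \<open>The sequence of permutations is indexed from 1.\<close>

definition perm_process :: "nat \<Rightarrow> (nat \<Rightarrow> nat \<Rightarrow> nat) measure" where
  "perm_process n = (\<Pi>\<^sub>M j\<in>{1..}. uniform_count_measure {p. p permutes {1..n}})"

text \<open>Rounds are numbered from 1; the value at \<open>k = 0\<close> is irrelevant.\<close>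

definition offered :: "nat \<Rightarrow> (nat \<Rightarrow> nat \<Rightarrow> nat) \<Rightarrow> nat \<Rightarrow> nat" where
  "offered n \<pi> k = \<pi> (nat \<lceil>real k / real n\<rceil>) (k - (k - 1) div n * n)"

text \<open>A strategy maps the list of pairs \<open>(u\<^sub>i, v\<^sub>i)\<close> of the previous rounds and the vertex
  offered in the current round to the vertex chosen by Builder. Loops are not excluded; they can
  never be used by a simple graph.\<close>

type_synonym strategy = "(nat \<times> nat) list \<Rightarrow> nat \<Rightarrow> nat"

definition strategies :: "nat \<Rightarrow> strategy set" where
  "strategies n = {S. \<forall>h v. S h v \<in> {1..n}}"

primrec history :: "nat \<Rightarrow> (nat \<Rightarrow> nat \<Rightarrow> nat) \<Rightarrow> strategy \<Rightarrow> nat \<Rightarrow> (nat \<times> nat) list" where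
  "history n \<pi> S 0 = []"
| "history n \<pi> S (Suc m) =
     history n \<pi> S m @
       [(S (history n \<pi> S m) (offered n \<pi> (Suc m)), offered n \<pi> (Suc m))]"

definition builder_graph :: "nat \<Rightarrow> (nat \<Rightarrow> nat \<Rightarrow> nat) \<Rightarrow> strategy \<Rightarrow> nat \<Rightarrow> nat set multiset" where
  "builder_graph n \<pi> S m = mset (map (\<lambda>(u, v). {u, v}) (history n \<pi> S m))"

definition hitting_time :: "graph set \<Rightarrow> nat \<Rightarrow> strategy \<Rightarrow> (nat \<Rightarrow> nat \<Rightarrow> nat) \<Rightarrow> enat" where
  "hitting_time F n S \<pi> =
     (INF m \<in> {m. \<exists>E\<in>F. E \<subseteq> set_mset (builder_graph n \<pi> S m)}. enat m)"

definition success_prob :: "graph set \<Rightarrow> nat \<Rightarrow> nat \<Rightarrow> strategy \<Rightarrow> real" where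
  "success_prob F n k S = \<P>(\<pi> in perm_process n. hitting_time F n S \<pi> \<le> enat k)"

text \<open>The variable \<open>\<tau>\<close> is specified through its distribution only, so it is rendered as a
  predicate on random variables \<open>T\<close> over an arbitrary probability space \<open>M\<close>. The maximum is
  over a finite set by \<open>finite_success_prob\<close>, and such a \<open>T\<close> exists by \<open>is_tau_lab_exists\<close>.\<close>

definition is_tau_lab :: "graph set \<Rightarrow> nat \<Rightarrow> 'a measure \<Rightarrow> ('a \<Rightarrow> enat) \<Rightarrow> bool" where
  "is_tau_lab F n M T \<longleftrightarrow>
     prob_space M \<and> T \<in> M \<rightarrow>\<^sub>M count_space UNIV \<and>
     (\<forall>k. \<P>(x in M. T x \<le> enat k) = Max (success_prob F n k ` strategies n))"

definition is_tau :: "graph set \<Rightarrow> nat \<Rightarrow> 'a measure \<Rightarrow> ('a \<Rightarrow> enat) \<Rightarrow> bool" where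
  "is_tau F n M T \<longleftrightarrow> is_tau_lab (iso_closure n F) n M T"

definition whp :: "(nat \<Rightarrow> 'a measure) \<Rightarrow> (nat \<Rightarrow> 'a \<Rightarrow> bool) \<Rightarrow> bool" where
  "whp M P \<longleftrightarrow> (\<lambda>n. \<P>(x in M n. P n x)) \<longlonglongrightarrow> 1"

subsection \<open>Well-definedness\<close>

lemma ceiling_div_eq:
  assumes "n > 0" "k > 0"
  shows "nat \<lceil>real k / real n\<rceil> = Suc ((k - 1) div n)"
proof -
  define q where "q = (k - 1) div n"
  define r where "r = (k - 1) mod n"
  have k: "k = q * n + r + 1" "r < n"
    using assms by (auto simp: q_def r_def)
  have kr: "real k = real q * real n + real r + 1" "real r + 1 \<le> real n" using k by auto
  have "\<lceil>real k / real n\<rceil> = int q + 1"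
    using assms kr by (intro ceiling_unique) (simp_all add: field_simps)
  thus ?thesis by (simp add: q_def)
qed

lemma prob_space_perm_process: "prob_space (perm_process n)"
  unfolding perm_process_def
proof (intro prob_space_PiM prob_space_uniform_count_measure)
  show "finite {p. p permutes {1..n}}" by (rule finite_permutations) simp
  show "{p. p permutes {1..n}} \<noteq> {}" using permutes_id by blast
qed

lemma perm_process_permutes:
  assumes "\<pi> \<in> space (perm_process n)" "j \<ge> 1"
  shows "\<pi> j permutes {1..n}"
  using assms by (auto simp: perm_process_def space_PiM space_uniform_count_measure PiE_def Pi_def)

lemma offered_in:
  assumes "\<pi> \<in> space (perm_process n)" "n > 0" "k > 0"
  shows "offered n \<pi> k \<in> {1..n}"
proof -
  have p: "\<pi> (Suc ((k - 1) div n)) permutes {1..n}"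
    using assms perm_process_permutes by simp
  have "k - (k - 1) div n * n = (k - 1) mod n + 1"
  proof -
    have "(k - 1) div n * n + (k - 1) mod n = k - 1" by (rule div_mult_mod_eq)
    thus ?thesis using assms(3) by linarith
  qed
  moreover have "(k - 1) mod n < n" using assms by simp
  ultimately have "k - (k - 1) div n * n \<in> {1..n}" by auto
  thus ?thesis unfolding offered_def ceiling_div_eq[OF assms(2,3)]
    using permutes_in_image[OF p] by blast
qed

lemma offered_measurable:
  assumes "n > 0" "k > 0"
  shows "(\<lambda>\<pi>. offered n \<pi> k) \<in> perm_process n \<rightarrow>\<^sub>M count_space UNIV"
proof -
  let ?j = "Suc ((k - 1) div n)"
  have "(\<lambda>\<pi>. \<pi> ?j) \<in> perm_process n \<rightarrow>\<^sub>M uniform_count_measure {p. p permutes {1..n}}"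
    unfolding perm_process_def by (rule measurable_component_singleton) simp
  moreover have "(\<lambda>p. p i) \<in> uniform_count_measure {p. p permutes {1..n}} \<rightarrow>\<^sub>M count_space UNIV"
    for i
    by (simp add: measurable_def sets_uniform_count_measure space_uniform_count_measure)
  ultimately show ?thesis unfolding offered_def ceiling_div_eq[OF assms]
    by (rule measurable_compose)
qed

definition offers :: "nat \<Rightarrow> nat \<Rightarrow> (nat \<Rightarrow> nat \<Rightarrow> nat) \<Rightarrow> nat list" where
  "offers n k \<pi> = map (\<lambda>i. offered n \<pi> (Suc i)) [0..<k]"

lemma offers_measurable:
  assumes "n > 0"
  shows "offers n k \<in> perm_process n \<rightarrow>\<^sub>M count_space UNIV"
proof (induction k)
  case 0
  show ?case by (simp add: offers_def)
next
  case (Suc k)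
  have "(\<lambda>\<pi>. offers n k \<pi> @ [offered n \<pi> (Suc k)]) \<in> perm_process n \<rightarrow>\<^sub>M count_space UNIV"
    by (rule measurable_compose_countable[OF _ Suc],
        rule measurable_compose[OF offered_measurable[OF assms]]) simp_all
  thus ?case by (simp add: offers_def)
qed

lemma history_cong:
  assumes "offers n k \<pi> = offers n k \<pi>'" "m \<le> k"
  shows "history n \<pi> S m = history n \<pi>' S m"
  using assms(2)
proof (induction m)
  case (Suc m)
  have "offered n \<pi> (Suc m) = offered n \<pi>' (Suc m)"
    using assms(1) Suc.prems by (auto simp: offers_def)
  thus ?case using Suc by simp
qed simp

lemma hitting_time_le_iff:
  "hitting_time F n S \<pi> \<le> enat k \<longleftrightarrow>
     (\<exists>m\<le>k. \<exists>E\<in>F. E \<subseteq> set_mset (builder_graph n \<pi> S m))" (is "_ \<longleftrightarrow> (\<exists>m\<le>k. ?P m)")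
proof
  assume le: "hitting_time F n S \<pi> \<le> enat k"
  have ne: "enat ` Collect ?P \<noteq> {}"
  proof
    assume "enat ` Collect ?P = {}"
    hence "hitting_time F n S \<pi> = \<infinity>" unfolding hitting_time_def by (simp add: Inf_enat_def)
    thus False using le by simp
  qed
  then obtain a where "a \<in> enat ` Collect ?P" by blast
  hence "hitting_time F n S \<pi> \<in> enat ` Collect ?P"
    unfolding hitting_time_def by (rule wellorder_InfI)
  then obtain m where "?P m" "hitting_time F n S \<pi> = enat m" by blast
  thus "\<exists>m\<le>k. ?P m" using le by (intro exI[of _ m]) simp
next
  assume "\<exists>m\<le>k. ?P m"
  then obtain m where m: "m \<le> k" "?P m" by blast
  have "hitting_time F n S \<pi> \<le> enat m"
    unfolding hitting_time_def using m(2) by (intro INF_lower) simp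
  thus "hitting_time F n S \<pi> \<le> enat k" using m(1) by (meson enat_ord_simps(1) order_trans)
qed

lemma success_event_eq:
  fixes F n k S
  defines "A \<equiv> {\<pi> \<in> space (perm_process n). hitting_time F n S \<pi> \<le> enat k}"
  shows "A = offers n k -` (offers n k ` A) \<inter> space (perm_process n)"
proof -
  have "\<pi> \<in> A" if "\<pi> \<in> space (perm_process n)" "\<pi>' \<in> A" "offers n k \<pi> = offers n k \<pi>'" for \<pi> \<pi>'
  proof -
    have eq: "builder_graph n \<pi> S m = builder_graph n \<pi>' S m" if "m \<le> k" for m
      using history_cong[OF \<open>offers n k \<pi> = offers n k \<pi>'\<close> that]
      by (simp add: builder_graph_def)
    have "hitting_time F n S \<pi>' \<le> enat k" using that(2) by (simp add: A_def)
    hence "hitting_time F n S \<pi> \<le> enat k"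
      unfolding hitting_time_le_iff using eq by metis
    thus ?thesis using that(1) by (simp add: A_def)
  qed
  thus ?thesis by (auto simp: A_def)
qed

lemma success_event_measurable:
  assumes "n > 0"
  shows "{\<pi> \<in> space (perm_process n). hitting_time F n S \<pi> \<le> enat k} \<in> sets (perm_process n)"
  by (subst success_event_eq, rule measurable_sets[OF offers_measurable[OF assms]]) simp

lemma finite_success_prob:
  assumes "n > 0"
  shows "finite (success_prob F n k ` strategies n)"
proof -
  let ?M = "perm_process n"
  let ?L = "{xs. set xs \<subseteq> {1..n} \<and> length xs = k}"
  let ?g = "\<lambda>A. measure ?M (offers n k -` A \<inter> space ?M)"
  have "success_prob F n k S \<in> ?g ` Pow ?L" for S
  proof -
    let ?A = "{\<pi> \<in> space ?M. hitting_time F n S \<pi> \<le> enat k}"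
    have "offers n k \<pi> \<in> ?L" if "\<pi> \<in> space ?M" for \<pi>
      using offered_in[OF that assms] by (auto simp: offers_def)
    hence "offers n k ` ?A \<subseteq> ?L" by blast
    moreover have "success_prob F n k S = ?g (offers n k ` ?A)"
      unfolding success_prob_def by (subst success_event_eq) simp
    ultimately show ?thesis by blast
  qed
  hence "success_prob F n k ` strategies n \<subseteq> ?g ` Pow ?L" by blast
  moreover have "finite (?g ` Pow ?L)"
    using finite_lists_length_eq[of "{1..n}" k] by simp
  ultimately show ?thesis by (rule finite_subset)
qed

lemma is_tau_lab_exists:
  assumes "n > 0"
  shows "\<exists>(M :: real measure) T. is_tau_lab F n M T"
proof -
  define p where "p k = Max (success_prob F n k ` strategies n)" for k
  interpret P: prob_space "perm_process n" by (rule prob_space_perm_process)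
  have fin: "finite (success_prob F n k ` strategies n)" for k
    by (rule finite_success_prob[OF assms])
  have ne: "strategies n \<noteq> {}"
  proof -
    have "(\<lambda>_ _. 1) \<in> strategies n" using assms by (simp add: strategies_def)
    thus ?thesis by blast
  qed
  have p_in: "p k \<in> success_prob F n k ` strategies n" for k
    unfolding p_def using fin ne by (intro Max_in) auto
  have p01: "0 \<le> p k" "p k \<le> 1" for k
    using p_in[of k] by (auto simp: success_prob_def)
  have mono: "p k \<le> p l" if "k \<le> l" for k l
  proof -
    obtain S where S: "S \<in> strategies n" "p k = success_prob F n k S" using p_in[of k] by blast
    have "success_prob F n k S \<le> success_prob F n l S"
      unfolding success_prob_def
      by (intro P.finite_measure_mono success_event_measurable assms)
         (use that in \<open>auto elim!: order_trans\<close>)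
    also have "\<dots> \<le> p l" unfolding p_def using fin S(1) by (intro Max_ge) auto
    finally show ?thesis using S(2) by simp
  qed
  define M where "M = uniform_measure lborel {0..1::real}"
  define T where "T x = (INF k \<in> {k. x \<le> p k}. enat k)" for x :: real
  have le_iff: "T x \<le> enat k \<longleftrightarrow> x \<le> p k" for x k
  proof
    assume le: "T x \<le> enat k"
    have ne: "{k. x \<le> p k} \<noteq> {}"
    proof
      assume "{k. x \<le> p k} = {}"
      hence "T x = \<infinity>" unfolding T_def by (simp add: Inf_enat_def)
      thus False using le by simp
    qed
    then obtain a where "enat a \<in> enat ` {k. x \<le> p k}" by blast
    hence "T x \<in> enat ` {k. x \<le> p k}" unfolding T_def by (rule wellorder_InfI)
    thus "x \<le> p k" using le mono order_trans by fastforce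
  next
    assume "x \<le> p k"
    thus "T x \<le> enat k" unfolding T_def by (intro INF_lower) simp
  qed
  have meas: "T \<in> M \<rightarrow>\<^sub>M count_space UNIV"
  proof -
    have "T -` {a} \<in> sets borel" for a
    proof (cases a)
      case (enat k)
      have "T x = enat k \<longleftrightarrow> x \<le> p k \<and> (\<forall>j\<in>{..<k}. \<not> x \<le> p j)" for x
      proof -
        have "T x = enat k \<longleftrightarrow> T x \<le> enat k \<and> (\<forall>j\<in>{..<k}. \<not> T x \<le> enat j)"
          by (cases "T x") (auto simp: not_le intro: antisym)
        thus ?thesis by (simp only: le_iff)
      qed
      hence "T -` {a} = {x \<in> space borel. x \<le> p k \<and> (\<forall>j\<in>{..<k}. \<not> x \<le> p j)}"
        by (auto simp: enat)
      also have "\<dots> \<in> sets borel" by measurable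
      finally show ?thesis .
    next
      case infinity
      have "T x = \<infinity> \<longleftrightarrow> (\<forall>j. \<not> x \<le> p j)" for x
      proof -
        have "T x = \<infinity> \<longleftrightarrow> (\<forall>j. \<not> T x \<le> enat j)" by (cases "T x") auto
        thus ?thesis by (simp only: le_iff)
      qed
      hence "T -` {a} = {x \<in> space borel. \<forall>j. \<not> x \<le> p j}"
        by (auto simp: infinity)
      also have "\<dots> \<in> sets borel" by measurable
      finally show ?thesis .
    qed
    thus ?thesis by (subst measurable_count_space_eq2_countable) (auto simp: M_def)
  qed
  have prob: "prob_space M"
    unfolding M_def by (rule prob_space_uniform_measure) auto
  have "\<P>(x in M. T x \<le> enat k) = p k" for k
  proof -
    have eq: "{x \<in> space M. T x \<le> enat k} = {..p k}" by (auto simp: M_def le_iff)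
    have "{0..1} \<inter> {..p k} = {0..p k}" using p01[of k] by auto
    thus ?thesis unfolding eq unfolding M_def
      using p01[of k] by (subst measure_uniform_measure) auto
  qed
  hence "is_tau_lab F n M T" using meas prob by (simp add: is_tau_lab_def p_def)
  thus ?thesis by blast
qed

end

theory Submission
  imports Defs
begin

text \<open>
  Write \<open>d = 2k\<close> or \<open>d = 2k + 1\<close>. Joining the vertex \<open>v\<close> offered in block \<open>j \<le> k\<close> to \<open>v + j\<close>
  modulo \<open>n\<close> builds a \<open>2k\<close>-regular circulant graph in \<open>kn\<close> rounds, and counting degrees shows
  that fewer rounds never suffice; this settles even \<open>d\<close>.

  For odd \<open>d\<close> only block \<open>k + 1\<close> matters. Let \<open>X\<^sub>i\<close> be the total degree deficiency after \<open>i\<close> of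
  its rounds. Each round lowers it by at most \<open>1\<close> through Builder's choice, and by a further
  \<open>B\<^sub>i \<in> {0, 1}\<close> through the offered vertex, where \<open>B\<^sub>i = 1\<close> has conditional probability at most
  \<open>X\<^sub>i / (n - i)\<close>. Hence \<open>X\<^sub>i / (n - i)\<close> plus the sum of \<open>1 / (n - j - 1)\<close> over \<open>j < i\<close> is a
  submartingale that starts at \<open>1\<close> or above. After the circulant graph it starts at \<open>1\<close>, and it
  is a martingale as long as Builder can join the offered vertex to a deficient non-neighbour.
  The sum is about \<open>ln (n / (n - i))\<close>, so \<open>X\<close> vanishes near \<open>i = (1 - 1/e) n\<close>; the variance is
  of order \<open>1/n\<close>, so Chebyshev's inequality gives a window of any width \<open>\<omega>(\<surd>n)\<close>.
  Finally, if \<open>u\<close> is still deficient, then every round so far without a suitable choice offered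
  a circulant neighbour of \<open>u\<close>, so at most \<open>2k\<close> rounds were wasted.
\<close>

subsection \<open>A martingale on random permutations\<close>

text \<open>Given \<open>p 1, \<dots>, p i\<close>, swapping positions \<open>i + 1\<close> and \<open>j > i\<close> shows that \<open>p (i + 1)\<close> is
  uniform on the values not yet used.\<close>

lemma sum_permutations_martingale_difference:
  fixes g :: "(nat \<Rightarrow> nat) \<Rightarrow> real" and P :: "(nat \<Rightarrow> nat) \<Rightarrow> nat set"
  assumes "i < n"
    and g: "\<And>p q. \<forall>j\<in>{1..i}. p j = q j \<Longrightarrow> g p = g q"
    and P: "\<And>p q. \<forall>j\<in>{1..i}. p j = q j \<Longrightarrow> P p = P q"
    and sub: "\<And>p. P p \<subseteq> {1..n} - p ` {1..i}"
  shows "(\<Sum>p | p permutes {1..n}.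
            g p * (indicat_real (P p) (p (Suc i)) - real (card (P p)) / real (n - i))) = 0"
proof -
  let ?\<Omega> = "{p. p permutes {1..n}}"
  define L where "L = (\<Sum>p\<in>?\<Omega>. g p * indicat_real (P p) (p (Suc i)))"
  have swap: "L = (\<Sum>p\<in>?\<Omega>. g p * indicat_real (P p) (p j))" if j: "j \<in> {Suc i..n}" for j
  proof -
    let ?s = "\<lambda>p. p \<circ> Transposition.transpose (Suc i) j"
    have tr: "Transposition.transpose (Suc i) j permutes {1..n}"
      using j by (intro permutes_swap_id) auto
    have eq: "?s p l = p l" if "l \<in> {1..i}" for p :: "nat \<Rightarrow> nat" and l
      using that j by (simp add: Transposition.transpose_def)
    show ?thesis unfolding L_def
    proof (rule sum.reindex_bij_witness[of _ ?s ?s])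
      fix p assume p: "p \<in> ?\<Omega>"
      show "?s (?s p) = p" by (simp add: comp_assoc)
      show "?s p \<in> ?\<Omega>" using permutes_compose[OF tr] p by simp
      have "g (?s p) = g p" "P (?s p) = P p"
        using g[of "?s p" p] P[of "?s p" p] eq[of _ p] by blast+
      thus "g (?s p) * indicat_real (P (?s p)) (?s p j) = g p * indicat_real (P p) (p (Suc i))"
        by simp
    next
      fix p assume p: "p \<in> ?\<Omega>"
      show "?s (?s p) = p" by (simp add: comp_assoc)
      show "?s p \<in> ?\<Omega>" using permutes_compose[OF tr] p by simp
    qed
  qed
  have cnt: "(\<Sum>j\<in>{Suc i..n}. indicat_real (P p) (p j)) = real (card (P p))" if p: "p \<in> ?\<Omega>" for p
  proof -
    have inj: "inj_on p {Suc i..n}" using p permutes_inj inj_on_subset by blast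
    have "p ` {Suc i..n} = p ` ({1..n} - {1..i})" by (rule arg_cong[of _ _ "image p"]) auto
    also have "\<dots> = {1..n} - p ` {1..i}"
      using p permutes_image[of p "{1..n}"] permutes_inj[of p "{1..n}"]
      by (simp add: image_set_diff)
    finally have im: "p ` {Suc i..n} = {1..n} - p ` {1..i}" .
    have "(\<Sum>j\<in>{Suc i..n}. indicat_real (P p) (p j)) = (\<Sum>x\<in>p ` {Suc i..n}. indicat_real (P p) x)"
      by (simp add: sum.reindex[OF inj] o_def)
    also have "\<dots> = real (card (P p))"
      unfolding im using sub[of p] by (subst sum.mono_neutral_right[of _ "P p"]) auto
    finally show ?thesis .
  qed
  \<comment> \<open>By \<open>swap\<close>, all \<open>n - i\<close> remaining positions give the
    same sum; by \<open>cnt\<close>, together they meet each element of \<open>P p\<close> exactly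
    once.\<close>
  have "real (n - i) * L = (\<Sum>j\<in>{Suc i..n}. L)" using \<open>i < n\<close> by simp
  also have "\<dots> = (\<Sum>j\<in>{Suc i..n}. \<Sum>p\<in>?\<Omega>. g p * indicat_real (P p) (p j))"
    by (intro sum.cong refl swap)
  also have "\<dots> = (\<Sum>p\<in>?\<Omega>. g p * real (card (P p)))"
    by (subst sum.swap) (simp add: sum_distrib_left[symmetric] cnt)
  finally have "L = (\<Sum>p\<in>?\<Omega>. g p * real (card (P p))) / real (n - i)"
    using \<open>i < n\<close> by (simp add: field_simps)
  thus ?thesis by (simp add: L_def right_diff_distrib sum_subtractf sum_divide_distrib)
qed

text \<open>The compensated sum over rounds \<open>i < s\<close> of the events \<open>p (i + 1) \<in> P i p\<close>. The weights
  \<open>1 / (n - i - 1)\<close> are those that turn \<open>X\<^sub>i / (n - i)\<close> into a martingale up to drift.\<close>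

definition block_martingale :: "nat \<Rightarrow> (nat \<Rightarrow> (nat \<Rightarrow> nat) \<Rightarrow> nat set) \<Rightarrow> (nat \<Rightarrow> nat) \<Rightarrow> nat \<Rightarrow> real"
    where
  "block_martingale n P p s
      = (\<Sum>i<s. (indicat_real (P i p) (p (Suc i)) - real (card (P i p)) / real (n - i))
                          / real (n - i - 1))"

text \<open>\<open>P i\<close> is known after \<open>i\<close> values and holds only values still to
  come, so \<open>card (P i p) / (n - i)\<close> is the conditional probability that the next value
  lies in it.\<close>

definition predictable :: "nat \<Rightarrow> (nat \<Rightarrow> (nat \<Rightarrow> nat) \<Rightarrow> nat set) \<Rightarrow> bool" where
  "predictable n P \<longleftrightarrow>
     (\<forall>i<n. \<forall>p. P i p \<subseteq> {1..n} - p ` {1..i}) \<and>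
     (\<forall>i<n. \<forall>p q. (\<forall>j\<in>{1..i}. p j = q j) \<longrightarrow> P i p = P i q)"

lemma block_martingale_cong:
  assumes "predictable n P" "s \<le> n" "\<forall>j\<in>{1..s}. p j = q j"
  shows "block_martingale n P p s = block_martingale n P q s"
proof -
  have "P i p = P i q" "p (Suc i) = q (Suc i)" if "i < s" for i
    using assms that by (auto simp: predictable_def)
  thus ?thesis by (simp add: block_martingale_def)
qed

text \<open>Martingale increments are orthogonal, so second moments add, and each compensated
  indicator is at most \<open>1\<close> in absolute value. Sums over permutations replace
  expectations, whence the factor \<open>fact n\<close>; \<open>s < n\<close> keeps all denominators
  positive.\<close>

lemma block_martingale_second_moment:
  assumes P: "predictable n P" and "s < n"
  shows "(\<Sum>p | p permutes {1..n}. (block_martingale n P p s)\<^sup>2)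
      \<le> fact n * (\<Sum>i<s. 1 / (real (n - i - 1))\<^sup>2)"
  using \<open>s < n\<close>
proof (induction s)
  case 0
  show ?case by (simp add: block_martingale_def)
next
  case (Suc s)
  let ?\<Omega> = "{p. p permutes {1..n}}"
  define c where "c = 1 / real (n - s - 1)"
  define \<delta> where "\<delta> p = indicat_real (P s p) (p (Suc s)) - real (card (P s p)) / real (n - s)" for p
  have step: "block_martingale n P p (Suc s) = block_martingale n P p s + c * \<delta> p" for p
    by (simp add: block_martingale_def c_def \<delta>_def)
  have \<delta>2: "(\<delta> p)\<^sup>2 \<le> 1" if p: "p \<in> ?\<Omega>" for p
  proof -
    have "card (P s p) \<le> card ({1..n} - p ` {1..s})"
      using P Suc.prems by (intro card_mono) (auto simp: predictable_def)
    also have "\<dots> = n - s"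
    proof -
      have "inj_on p {1..s}" using p permutes_inj inj_on_subset by blast
      moreover have "p ` {1..s} \<subseteq> {1..n}"
        using p permutes_image[of p "{1..n}"] Suc.prems by (fastforce simp: permutes_in_image)
      ultimately show ?thesis by (simp add: card_Diff_subset card_image)
    qed
    finally have "real (card (P s p)) / real (n - s) \<le> 1"
      using Suc.prems by (simp add: field_simps)
    moreover have "0 \<le> real (card (P s p)) / real (n - s)" by simp
    ultimately have "\<bar>\<delta> p\<bar> \<le> 1" unfolding \<delta>_def
      by (cases "p (Suc s) \<in> P s p") (simp_all add: abs_le_iff)
    thus ?thesis by (simp add: abs_square_le_1)
  qed
  \<comment> \<open>The partial sum depends on \<open>p\<close> only through its first
    \<open>s\<close> values, so it may serve as the factor \<open>g\<close>.\<close>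
  have orth: "(\<Sum>p\<in>?\<Omega>. block_martingale n P p s * \<delta> p) = 0" unfolding \<delta>_def
    using P Suc.prems block_martingale_cong[OF P, of s]
    by (intro sum_permutations_martingale_difference) (auto simp: predictable_def)
  have "(\<Sum>p\<in>?\<Omega>. (block_martingale n P p (Suc s))\<^sup>2)
      = (\<Sum>p\<in>?\<Omega>. (block_martingale n P p s)\<^sup>2) + 2 * c * (\<Sum>p\<in>?\<Omega>. block_martingale n P p s * \<delta> p)
          + c\<^sup>2 * (\<Sum>p\<in>?\<Omega>. (\<delta> p)\<^sup>2)"
    unfolding step sum_distrib_left sum.distrib[symmetric]
    by (intro sum.cong refl) (simp add: power2_eq_square algebra_simps)
  also have "\<dots> \<le> fact n * (\<Sum>i<s. 1 / (real (n - i - 1))\<^sup>2) + c\<^sup>2 * (\<Sum>p\<in>?\<Omega>. 1)"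
    unfolding orth using Suc \<delta>2 by (intro add_mono mult_left_mono sum_mono) auto
  also have "(\<Sum>p\<in>?\<Omega>. 1::real) = fact n"
    by (simp add: card_permutations[of "{1..n}" n] del: One_nat_def)
  finally show ?case by (simp add: c_def power_divide algebra_simps)
qed

text \<open>Stated as a count of permutations, the form in which
  \<open>perm_process_resample\<close> takes it.\<close>

lemma block_martingale_chebyshev:
  assumes "predictable n P" "s < n" "a > 0"
  shows "real (card {p. p permutes {1..n} \<and> \<bar>block_martingale n P p s\<bar> \<ge> a})
           \<le> (\<Sum>i<s. 1 / (real (n - i - 1))\<^sup>2) / a\<^sup>2 * fact n"
proof -
  let ?B = "{p. p permutes {1..n} \<and> \<bar>block_martingale n P p s\<bar> \<ge> a}"
  have fin: "finite {p. p permutes {1..n}}" by (rule finite_permutations) simp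
  have "real (card ?B) * a\<^sup>2 = (\<Sum>p\<in>?B. a\<^sup>2)" by simp
  also have "\<dots> \<le> (\<Sum>p\<in>?B. (block_martingale n P p s)\<^sup>2)"
    using assms(3) by (intro sum_mono) (auto simp: abs_le_square_iff[symmetric])
  also have "\<dots> \<le> (\<Sum>p | p permutes {1..n}. (block_martingale n P p s)\<^sup>2)"
    by (intro sum_mono2 fin) auto
  also have "\<dots> \<le> fact n * (\<Sum>i<s. 1 / (real (n - i - 1))\<^sup>2)"
    by (rule block_martingale_second_moment[OF assms(1,2)])
  finally show ?thesis using assms(3) by (simp add: field_simps)
qed

subsection \<open>The permutation process\<close>

text \<open>Fubini: block \<open>j\<close> is independent of the others, so a bound valid for every
  choice of the other blocks holds overall. This reduces the infinite product to counting
  permutations of a single block.\<close>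

lemma perm_process_resample:
  assumes A: "A \<in> sets (perm_process n)" and "j \<ge> 1" "\<epsilon> \<ge> 0"
    and le: "\<And>\<rho>. \<rho> \<in> space (perm_process n) \<Longrightarrow>
               real (card {p. p permutes {1..n} \<and> \<rho>(j := p) \<in> A}) \<le> \<epsilon> * fact n"
  shows "measure (perm_process n) A \<le> \<epsilon>"
proof -
  let ?\<Omega> = "{p. p permutes {1..n}}"
  let ?U = "uniform_count_measure ?\<Omega>"
  let ?R = "\<Pi>\<^sub>M i\<in>{1..}-{j}. ?U"
  have fin: "finite ?\<Omega>" by (rule finite_permutations) simp
  have U: "prob_space ?U"
    using fin permutes_id by (intro prob_space_uniform_count_measure) blast+
  have R: "prob_space ?R" using U by (intro prob_space_PiM)
  interpret U: prob_space ?U by (rule U)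
  interpret R: prob_space ?R by (rule R)
  interpret UR: pair_sigma_finite ?U ?R ..
  interpret Pp: prob_space "perm_process n" by (rule prob_space_perm_process)
  have ins: "insert j ({1..}-{j}) = {1..}" using \<open>j \<ge> 1\<close> by auto
  let ?f = "\<lambda>(x, X). X(j := x)"
  have eq: "perm_process n = distr (?U \<Otimes>\<^sub>M ?R) (perm_process n) ?f"
    unfolding perm_process_def
    by (rule distr_pair_PiM_eq_PiM[of "{1..}-{j}" "\<lambda>_. ?U" j, OF U U, unfolded ins, symmetric])
  have m: "?f \<in> ?U \<Otimes>\<^sub>M ?R \<rightarrow>\<^sub>M perm_process n"
  proof -
    have "?f \<in> ?U \<Otimes>\<^sub>M ?R \<rightarrow>\<^sub>M (\<Pi>\<^sub>M i\<in>insert j ({1..}-{j}). ?U)" by measurable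
    thus ?thesis unfolding ins perm_process_def .
  qed
  let ?B = "?f -` A \<inter> space (?U \<Otimes>\<^sub>M ?R)"
  have B: "?B \<in> sets (?U \<Otimes>\<^sub>M ?R)" using m A by (rule measurable_sets)
  have "emeasure (perm_process n) A = emeasure (?U \<Otimes>\<^sub>M ?R) ?B"
    by (subst eq) (rule emeasure_distr[OF m A])
  also have "\<dots> = (\<integral>\<^sup>+X. emeasure ?U ((\<lambda>x. (x, X)) -` ?B) \<partial>?R)"
    by (rule UR.emeasure_pair_measure_alt2[OF B])
  also have "\<dots> \<le> (\<integral>\<^sup>+X. ennreal \<epsilon> \<partial>?R)"
  proof (rule nn_integral_mono)
    fix X assume X: "X \<in> space ?R"
    \<comment> \<open>Coordinate \<open>j\<close> is missing from \<open>X\<close>;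
      \<open>id\<close> is a placeholder that every update \<open>\<rho>(j := p)\<close>
      overwrites.\<close>
    define \<rho> where "\<rho> = X(j := id)"
    have "(id, X) \<in> space (?U \<Otimes>\<^sub>M ?R)"
      using X by (simp add: space_pair_measure space_uniform_count_measure permutes_id)
    from measurable_space[OF m this] have \<rho>: "\<rho> \<in> space (perm_process n)" by (simp add: \<rho>_def)
    have S: "(\<lambda>x. (x, X)) -` ?B = {p. p permutes {1..n} \<and> \<rho>(j := p) \<in> A}"
      using X by (auto simp: space_pair_measure space_uniform_count_measure \<rho>_def)
    have "emeasure ?U ((\<lambda>x. (x, X)) -` ?B)
        = ennreal (real (card {p. p permutes {1..n} \<and> \<rho>(j := p) \<in> A}) / fact n)"
      unfolding S using fin
      by (subst emeasure_uniform_count_measure) (auto simp del: One_nat_def simp: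
          card_permutations[of "{1..n}" n])
    also have "\<dots> \<le> ennreal \<epsilon>" using le[OF \<rho>] by (intro ennreal_leI) (simp add: field_simps)
    finally show "emeasure ?U ((\<lambda>x. (x, X)) -` ?B) \<le> ennreal \<epsilon>" .
  qed
  also have "\<dots> = ennreal \<epsilon>" using R.emeasure_space_1 by (simp del: One_nat_def)
  finally show ?thesis using \<open>\<epsilon> \<ge> 0\<close> by (simp add: Pp.emeasure_eq_measure)
qed

section \<open>Offers and histories, block by block\<close>

lemma offered_Suc:
  assumes "n > 0"
  shows "offered n \<pi> (Suc m) = \<pi> (Suc (m div n)) (Suc (m mod n))"
proof -
  have "Suc m - m div n * n = Suc (m mod n)"
    using div_mult_mod_eq[of m n] by linarith
  thus ?thesis unfolding offered_def using ceiling_div_eq[OF assms, of "Suc m"] by simp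
qed

lemma offered_block:
  assumes "r < n"
  shows "offered n \<pi> (Suc (k * n + r)) = \<pi> (Suc k) (Suc r)"
  using assms by (subst offered_Suc) (auto simp: div_mult_self3)

text \<open>Rounds before block \<open>k + 1\<close> do not read its permutation, and its first
  \<open>i\<close> rounds read only \<open>i\<close> values. Hence sets defined from the history
  inside this block are predictable.\<close>

lemma history_resample_cong:
  assumes "i \<le> n" "\<forall>j\<in>{1..i}. p j = q j"
  shows "history n (\<rho>(Suc k := p)) S (k * n + i) = history n (\<rho>(Suc k := q)) S (k * n + i)"
proof (cases "n = 0")
  case False
  hence n: "n > 0" by simp
  have "offered n (\<rho>(Suc k := p)) (Suc m) = offered n (\<rho>(Suc k := q)) (Suc m)"
    if "m < k * n + i" for m
  proof (cases "m < k * n")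
    case True
    hence "m div n < k" by (simp add: n div_less_iff_less_mult)
    thus ?thesis by (simp add: offered_Suc[OF n])
  next
    case False
    then obtain r where "m = k * n + r" using le_Suc_ex by (metis not_less)
    with that assms show ?thesis by (simp add: offered_block)
  qed
  thus ?thesis by (intro history_cong[OF _ order_refl]) (auto simp: offers_def)
qed (use assms in simp)

lemma length_history [simp]: "length (history n \<pi> S m) = m"
  by (induction m) auto

lemma set_history:
  "set (history n \<pi> S m) =
     (\<lambda>i. (S (history n \<pi> S i) (offered n \<pi> (Suc i)), offered n \<pi> (Suc i))) ` {..<m}"
  by (induction m) (auto simp: lessThan_Suc)

subsection \<open>Degree deficiency\<close>

text \<open>A loop counts twice.\<close>

definition multidegree :: "(nat \<times> nat) list \<Rightarrow> nat \<Rightarrow> nat" where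
  "multidegree h w = count_list (map fst h) w + count_list (map snd h) w"

text \<open>The truncated subtraction matters: excess degree at one vertex cannot offset a shortage
  at another.\<close>

definition deficiency :: "nat \<Rightarrow> nat \<Rightarrow> (nat \<times> nat) list \<Rightarrow> nat" where
  "deficiency n d h = (\<Sum>w=1..n. d - multidegree h w)"

lemma multidegree_snoc: "multidegree (h @ [(u, v)]) w = multidegree h w + (if w = u then 1 else 0)
    + (if w = v then 1 else 0)"
  by (simp add: multidegree_def)

lemma sum_multidegree_le: "(\<Sum>w=1..n. multidegree h w) \<le> 2 * length h"
proof (induction h rule: rev_induct)
  case Nil show ?case by (simp add: multidegree_def)
next
  case (snoc x h)
  obtain u v where x: "x = (u, v)" by fastforce
  have "(\<Sum>w=1..n. if w = y then 1 else 0::nat) \<le> 1" for y by (simp add: sum.delta')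
  from this[of u] this[of v] snoc show ?case by (simp add: x multidegree_snoc sum.distrib)
qed

text \<open>Handshake count: each pair contributes at most \<open>2\<close> to the degree
  sum.\<close>

lemma deficiency_ge: "d * n \<le> deficiency n d h + 2 * length h"
proof -
  have "d * n = (\<Sum>w=1..n. d)" by simp
  also have "\<dots> \<le> (\<Sum>w=1..n. (d - multidegree h w) + multidegree h w)" by (intro sum_mono) simp
  finally show ?thesis using sum_multidegree_le[of h n] by (simp add: deficiency_def sum.distrib)
qed

text \<open>The chosen vertex is charged \<open>1\<close> unconditionally, the offered one only if
  it was still deficient. This also covers the loop \<open>u = v\<close>.\<close>

lemma deficiency_snoc_ge:
  "deficiency n d h \<le> deficiency n d (h @ [(u, v)]) + 1 + (if v \<in> {1..n}
      \<and> multidegree h v < d then 1 else 0)"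
proof -
  let ?b = "if multidegree h v < d then 1 else 0 :: nat"
  have "deficiency n d h
      \<le> (\<Sum>w=1..n. (d - multidegree (h @ [(u, v)]) w) + (if w = u then 1 else 0) + (if w
          = v then ?b else 0))"
    unfolding deficiency_def by (intro sum_mono) (auto simp: multidegree_snoc)
  also have "\<dots> \<le> deficiency n d (h @ [(u, v)]) + 1 + (if v \<in> {1..n}
      \<and> multidegree h v < d then 1 else 0)"
    by (simp add: sum.distrib deficiency_def)
  finally show ?thesis .
qed

text \<open>Parallel pairs merge into one edge and loops count twice on the right, so the multigraph
  degree dominates the degree in any simple subgraph.\<close>

lemma card_incident_le_multidegree: "card {e \<in> (\<lambda>(u, w). {u, w}) ` set h. v \<in> e} \<le> multidegree h v"
proof (induction h)
  case (Cons x h)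
  obtain u w where x: "x = (u, w)" by fastforce
  let ?D = "\<lambda>h. {e \<in> (\<lambda>(u, w). {u, w}) ` set h. v \<in> e}"
  show ?case
  proof (cases "v \<in> {u, w}")
    case True
    have "card (?D (x # h)) \<le> card (insert {u, w} (?D h))" by (intro card_mono) (auto simp: x)
    also have "\<dots> \<le> Suc (card (?D h))" by (intro card_insert_le_m1) auto
    finally show ?thesis using Cons True by (auto simp: x multidegree_def)
  next
    case False
    hence "?D (x # h) = ?D h" by (auto simp: x)
    thus ?thesis using Cons by (auto simp: multidegree_def)
  qed
qed simp

section \<open>From the graph family to deficiencies\<close>

text \<open>An isomorphism \<open>\<phi>\<close> carries the edges at \<open>w\<close> injectively
  to edges at \<open>\<phi> w\<close>, so closing under isomorphism keeps the degree bound.\<close>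

lemma iso_closure_vertex_degree:
  assumes E: "E \<in> iso_closure n (min_degree_family d n)" and v: "v \<in> {1..n}"
  shows "d \<le> vertex_degree E v"
proof -
  obtain H \<phi> where H: "simple_graph n H" "d \<le> min_degree n H"
    and \<phi>: "bij_betw \<phi> {1..n} {1..n}" and EH: "E = (\<lambda>e. \<phi> ` e) ` H" and sE: "simple_graph n E"
    using E by (auto simp: iso_closure_def min_degree_family_def)
  obtain w where w: "w \<in> {1..n}" "\<phi> w = v"
    using bij_betw_imp_surj_on[OF \<phi>] v by (metis imageE)
  have "d \<le> vertex_degree H w"
    using H(2) Min_le[of "vertex_degree H ` {1..n}" "vertex_degree H w"] w(1)
    by (simp add: min_degree_def)
  also have "\<dots> = card ((\<lambda>e. \<phi> ` e) ` {e \<in> H. w \<in> e})"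
    unfolding vertex_degree_def
  proof (intro card_image[symmetric] inj_on_subset[OF inj_on_image_Pow[of \<phi> "{1..n}"]])
    show "inj_on \<phi> {1..n}" using \<phi> by (simp add: bij_betw_def)
    show "{e \<in> H. w \<in> e} \<subseteq> Pow {1..n}" using H(1) by (auto simp: simple_graph_def)
  qed
  also have "\<dots> \<le> vertex_degree E v"
    unfolding vertex_degree_def
  proof (rule card_mono)
    have "E \<subseteq> Pow {1..n}" using sE by (auto simp: simple_graph_def)
    hence "finite E" by (rule finite_subset) simp
    thus "finite {e \<in> E. v \<in> e}" by simp
    show "(\<lambda>e. \<phi> ` e) ` {e \<in> H. w \<in> e} \<subseteq> {e \<in> E. v \<in> e}" using EH w by auto
  qed
  finally show ?thesis .
qed

lemma set_mset_builder_graph: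
  "set_mset (builder_graph n \<pi> S m) = (\<lambda>(u, v). {u, v}) ` set (history n \<pi> S m)"
  by (simp add: builder_graph_def)

text \<open>Edges are never removed, so only the last graph has to be inspected.\<close>

lemma hitting_time_le_iff_final:
  "hitting_time F n S \<pi> \<le> enat k \<longleftrightarrow> (\<exists>E\<in>F. E \<subseteq> set_mset (builder_graph n \<pi> S k))"
proof -
  have "set_mset (builder_graph n \<pi> S m) \<subseteq> set_mset (builder_graph n \<pi> S k)" if "m \<le> k" for m
    unfolding set_mset_builder_graph using that by (intro image_mono) (auto simp: set_history)
  thus ?thesis unfolding hitting_time_le_iff by blast
qed

lemma hit_imp_deficiency_0:
  assumes "hitting_time (iso_closure n (min_degree_family d n)) n S \<pi> \<le> enat k"
  shows "deficiency n d (history n \<pi> S k) = 0"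
proof -
  obtain E where E: "E \<in> iso_closure n (min_degree_family d n)"
    and sub: "E \<subseteq> (\<lambda>(u, v). {u, v}) ` set (history n \<pi> S k)"
    using assms by (auto simp: hitting_time_le_iff_final set_mset_builder_graph)
  have "d \<le> multidegree (history n \<pi> S k) v" if "v \<in> {1..n}" for v
  proof -
    have "d \<le> vertex_degree E v" by (rule iso_closure_vertex_degree[OF E that])
    also have "\<dots> \<le> card {e \<in> (\<lambda>(u, v). {u, v}) ` set (history n \<pi> S k). v \<in> e}"
      unfolding vertex_degree_def using sub by (intro card_mono) auto
    also have "\<dots> \<le> multidegree (history n \<pi> S k) v" by (rule card_incident_le_multidegree)
    finally show ?thesis .
  qed
  thus ?thesis by (simp add: deficiency_def)
qed

section \<open>Lower bound for odd degree, for every strategy\<close>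

text \<open>The first \<open>k * n\<close> rounds supply degree sum at most \<open>2 k n\<close>, so
  the block starts with deficiency at least \<open>n\<close>. The set \<open>P i\<close> of
  deficient vertices not yet offered has at most as many elements as the current deficiency, which
  bounds the conditional probability that the offer helps.\<close>

lemma deficiency_martingale_bound:
  fixes n k :: nat and S :: strategy
  assumes q: "\<pi> (Suc k) permutes {1..n}" and "s < n"
    and P: "\<And>i. i < s \<Longrightarrow> P i (\<pi> (Suc k)) =
              {v \<in> {1..n} - \<pi> (Suc k) ` {1..i}. multidegree (history n \<pi> S (k * n + i)) v < 2 * k
                  + 1}"
  shows "1 - (\<Sum>i<s. 1 / real (n - i - 1)) - block_martingale n P (\<pi> (Suc k)) s
           \<le> real (deficiency n (2 * k + 1) (history n \<pi> S (k * n + s))) / real (n - s)"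
  using \<open>s < n\<close> P
proof (induction s)
  case 0
  have "n \<le> deficiency n (2 * k + 1) (history n \<pi> S (k * n))"
    using deficiency_ge[of "2 * k + 1" n "history n \<pi> S (k * n)"]
    by (simp add: algebra_simps)
  thus ?case using 0(1) by (simp add: block_martingale_def)
next
  case (Suc s)
  define q where "q = \<pi> (Suc k)"
  note q = q[folded q_def] and P = Suc.prems(2)[of s, folded q_def, simplified]
  let ?h = "\<lambda>i. history n \<pi> S (k * n + i)"
  define D where "D i = real (deficiency n (2 * k + 1) (?h i))" for i
  define c where "c = 1 / real (n - s - 1)"
  define B where "B = indicat_real (P s q) (q (Suc s))"
  define p where "p = real (card (P s q)) / real (n - s)"
  have ns: "real (n - s) = real (n - s - 1) + 1" "real (n - s - 1) > 0" using Suc.prems(1) by auto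
  have IH: "1 - (\<Sum>i<s. 1 / real (n - i - 1)) - block_martingale n P q s \<le> D s / real (n - s)"
    unfolding D_def q_def using Suc by simp
  have p_le: "p \<le> D s / real (n - s)"
  proof -
    have "card (P s q) = (\<Sum>v\<in>P s q. 1)" by simp
    also have "\<dots> \<le> (\<Sum>v\<in>P s q. 2 * k + 1 - multidegree (?h s) v)" by (intro sum_mono) (auto simp: P)
    also have "\<dots> \<le> deficiency n (2 * k + 1) (?h s)"
      unfolding deficiency_def by (intro sum_mono2) (auto simp: P)
    finally show ?thesis by (simp add: p_def D_def divide_right_mono)
  qed
  have new: "q (Suc s) \<in> {1..n} - q ` {1..s}"
  proof
    show "q (Suc s) \<in> {1..n}" using Suc.prems(1) by (subst permutes_in_image[OF q]) simp
    show "q (Suc s) \<notin> q ` {1..s}"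
      using permutes_inj[OF q] by (subst inj_image_mem_iff) auto
  qed
  have off: "offered n \<pi> (Suc (k * n + s)) = q (Suc s)"
    using Suc.prems(1) by (subst offered_block) (auto simp: q_def)
  have "deficiency n (2 * k + 1) (?h s) \<le> deficiency n (2 * k + 1) (?h (Suc s)) + 1
          + (if q (Suc s) \<in> {1..n} \<and> multidegree (?h s) (q (Suc s)) < 2 * k + 1 then 1 else 0)"
    using deficiency_snoc_ge[of n "2 * k + 1" "?h s" _ "q (Suc s)"]
      by (simp add: off del: atLeastAtMost_iff)
  hence "D s \<le> D (Suc s) + 1 + B"
    using new by (cases "multidegree (?h s) (q (Suc s)) < 2 * k
        + 1") (simp_all add: D_def B_def P del: of_nat_add)
  hence "c * (D s - 1 - B) \<le> c * D (Suc s)" by (intro mult_left_mono) (auto simp: c_def)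
  moreover have "c * p \<le> c * (D s / real (n - s))" using p_le
    by (intro mult_left_mono) (auto simp: c_def)
  \<comment> \<open>This is \<open>1 / m * (1 - 1 / (m + 1)) = 1 / (m + 1)\<close> with
    \<open>m = n - s - 1\<close>: the expected loss through the offer is absorbed by passing from
    denominator \<open>n - s\<close> to \<open>n - s - 1\<close>.\<close>
  moreover have "c * D s - c * (D s / real (n - s)) = D s / real (n - s)"
    unfolding c_def ns(1) using ns(2) by (simp add: divide_simps) (simp add: algebra_simps)
  moreover have "block_martingale n P q (Suc s) = block_martingale n P q s + c * (B - p)"
    by (simp add: block_martingale_def B_def p_def c_def)
  moreover have "c * D (Suc s) = D (Suc s) / real (n - Suc s)" by (simp add: c_def)
  moreover define E where "E = D s / real (n - s)"
  moreover define F where "F = D (Suc s) / real (n - Suc s)"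
  moreover define G where "G = (\<Sum>i<s. 1 / real (n - i - 1))"
  ultimately have "1 - ((\<Sum>i<s. 1 / real (n - i - 1)) + c) - block_martingale n P q (Suc s)
      \<le> D (Suc s) / real (n - Suc s)"
    using IH unfolding right_diff_distrib E_def[symmetric] F_def[symmetric] G_def[symmetric] by
        linarith
  thus ?case by (simp only: sum.lessThan_Suc c_def D_def q_def)
qed

text \<open>Success means deficiency \<open>0\<close>, and then the preceding bound forces the
  martingale to reach \<open>a\<close>. Chebyshev's inequality applies to block \<open>k + 1\<close>
  with all other blocks frozen.\<close>

lemma success_prob_odd_le:
  fixes n k s :: nat
  defines "a \<equiv> 1 - (\<Sum>i<s. 1 / real (n - i - 1))"
  assumes "s < n" "a > 0"
  shows "success_prob (iso_closure n (min_degree_family (2 * k + 1) n)) n (k * n + s) S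
           \<le> (\<Sum>i<s. 1 / (real (n - i - 1))\<^sup>2) / a\<^sup>2"
  unfolding success_prob_def
proof (rule perm_process_resample[of _ _ "Suc k"])
  let ?F = "iso_closure n (min_degree_family (2 * k + 1) n)"
  let ?A = "{\<pi> \<in> space (perm_process n). hitting_time ?F n S \<pi> \<le> enat (k * n + s)}"
  show "?A \<in> sets (perm_process n)" using \<open>s < n\<close> by (intro success_event_measurable) auto
  show "0 \<le> (\<Sum>i<s. 1 / (real (n - i - 1))\<^sup>2) / a\<^sup>2" by (intro divide_nonneg_nonneg sum_nonneg) auto
  fix \<rho> assume "\<rho> \<in> space (perm_process n)"
  \<comment> \<open>With the other blocks fixed in \<open>\<rho>\<close>, this is a function of the
    permutation of block \<open>k + 1\<close> alone.\<close>
  define P where "P i q = {v \<in> {1..n} - q ` {1..i}. multidegree (history n (\<rho>(Suc k := q)) S (k * n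
      + i)) v < 2 * k + 1}"
    for i and q :: "nat \<Rightarrow> nat"
  have pred: "predictable n P"
  proof -
    have "P i p = P i q" if "i < n" "\<forall>j\<in>{1..i}. p j = q j" for i p q
    proof -
      have "p ` {1..i} = q ` {1..i}" using that by (intro image_cong) auto
      thus ?thesis using history_resample_cong[of i n p q \<rho> k S] that by (simp add: P_def)
    qed
    moreover have "P i p \<subseteq> {1..n} - p ` {1..i}" for i p unfolding P_def by blast
    ultimately show ?thesis unfolding predictable_def by blast
  qed
  have "\<bar>block_martingale n P q s\<bar> \<ge> a" if "q permutes {1..n}" "\<rho>(Suc k := q) \<in> ?A" for q
  proof -
    define \<pi> where "\<pi> = \<rho>(Suc k := q)"
    have "deficiency n (2 * k + 1) (history n \<pi> S (k * n + s)) = 0"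
      using that(2) unfolding \<pi>_def by (intro hit_imp_deficiency_0) blast
    moreover have "1 - (\<Sum>i<s. 1 / real (n - i - 1)) - block_martingale n P (\<pi> (Suc k)) s
           \<le> real (deficiency n (2 * k + 1) (history n \<pi> S (k * n + s))) / real (n - s)"
    proof (rule deficiency_martingale_bound[OF _ \<open>s < n\<close>])
      have eq: "\<pi> (Suc k) = q" by (simp add: \<pi>_def)
      show "\<pi> (Suc k) permutes {1..n}" using that(1) by (simp only: eq)
      show "P i (\<pi> (Suc k)) =
              {v \<in> {1..n} - \<pi> (Suc k) ` {1..i}. multidegree (history n \<pi> S (k * n + i)) v < 2 * k
                  + 1}" for i
        by (simp only: eq P_def \<pi>_def[symmetric])
    qed
    ultimately show ?thesis by (simp add: \<pi>_def a_def)
  qed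
  hence "card {p. p permutes {1..n} \<and> \<rho>(Suc k := p) \<in> ?A}
      \<le> card {p. p permutes {1..n} \<and> \<bar>block_martingale n P p s\<bar> \<ge> a}"
    by (intro card_mono) (auto intro: finite_subset[OF _ finite_permutations[of "{1..n}"]])
  also have "real \<dots> \<le> (\<Sum>i<s. 1 / (real (n - i - 1))\<^sup>2) / a\<^sup>2 * fact n"
    by (rule block_martingale_chebyshev[OF pred \<open>s < n\<close> \<open>a > 0\<close>])
  finally show "real (card {p. p permutes {1..n} \<and> \<rho>(Suc k := p) \<in> ?A})
                  \<le> (\<Sum>i<s. 1 / (real (n - i - 1))\<^sup>2) / a\<^sup>2 * fact n" by simp
qed simp

lemma success_prob_few_rounds:
  assumes "2 * m < d * n"
  shows "success_prob (iso_closure n (min_degree_family d n)) n m S = 0"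
proof -
  have "deficiency n d (history n \<pi> S m) \<noteq> 0" for \<pi>
    using deficiency_ge[of d n "history n \<pi> S m"] assms by auto
  hence "{\<pi> \<in> space (perm_process n). hitting_time (iso_closure n (min_degree_family d n)) n S \<pi>
      \<le> enat m} = {}"
    using hit_imp_deficiency_0 by blast
  thus ?thesis unfolding success_prob_def by (simp only: measure_empty)
qed

subsection \<open>The circulant strategy\<close>

text \<open>The vertex \<open>v + j\<close> modulo \<open>n\<close>, with representatives \<open>1, \<dots>, n\<close>.\<close>

definition circ_shift :: "nat \<Rightarrow> nat \<Rightarrow> int \<Rightarrow> nat" where
  "circ_shift n v j = nat ((int v + j - 1) mod int n) + 1"

text \<open>Offsets are signed: \<open>v\<close> adds the positive ones when it is offered, and the
  negative ones are added when the vertices \<open>v - j\<close> are offered.\<close>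

definition circ_nbrs :: "nat \<Rightarrow> nat \<Rightarrow> nat \<Rightarrow> nat set" where
  "circ_nbrs n k v = circ_shift n v ` ({- int k..int k} - {0})"

lemma circ_shift_in: "n > 0 \<Longrightarrow> circ_shift n v j \<in> {1..n}"
  by (simp add: circ_shift_def Suc_le_eq nat_less_iff)

lemma circ_shift_0: "v \<in> {1..n} \<Longrightarrow> circ_shift n v 0 = v"
  by (auto simp: circ_shift_def)

lemma circ_shift_circ:
  assumes "n > 0"
  shows "circ_shift n (circ_shift n v i) j = circ_shift n v (i + j)"
proof -
  have "int (circ_shift n v i) = (int v + i - 1) mod int n + 1" using assms
    by (simp add: circ_shift_def)
  hence "(int (circ_shift n v i) + j - 1) mod int n = ((int v + i - 1) mod int n + j) mod int n"
    by (simp add: algebra_simps)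
  also have "\<dots> = (int v + (i + j) - 1) mod int n" unfolding mod_add_left_eq
    by (simp add: algebra_simps)
  finally show ?thesis by (simp add: circ_shift_def)
qed

text \<open>Two offsets differ by at most \<open>2 k < n\<close>, so congruence modulo
  \<open>n\<close> forces equality. Hence the circulant graph has degree exactly
  \<open>2 k\<close>.\<close>

lemma inj_on_circ:
  assumes "2 * k < n"
  shows "inj_on (circ_shift n v) {- int k..int k}"
proof (rule inj_onI)
  fix i j assume ij: "i \<in> {- int k..int k}" "j \<in> {- int k..int k}" "circ_shift n v i
      = circ_shift n v j"
  have "(int v + i - 1) mod int n = (int v + j - 1) mod int n"
    using ij(3) assms by (simp add: circ_shift_def eq_nat_nat_iff)
  hence "int n dvd (int v + i - 1) - (int v + j - 1)" by (simp only: mod_eq_dvd_iff)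
  hence d: "int n dvd i - j" by simp
  have "\<bar>i - j\<bar> < int n" using ij(1,2) assms by auto
  with d have "i - j = 0" using zdvd_not_zless[of "\<bar>i - j\<bar>" "int n"] by force
  thus "i = j" by simp
qed

lemma circ_nbrs_subset: "n > 0 \<Longrightarrow> circ_nbrs n k v \<subseteq> {1..n}"
  using circ_shift_in by (auto simp: circ_nbrs_def simp del: atLeastAtMost_iff)

lemma card_nbrs:
  assumes "2 * k < n"
  shows "card (circ_nbrs n k v) = 2 * k"
proof -
  have "card (circ_nbrs n k v) = card ({- int k..int k} - {0})"
    unfolding circ_nbrs_def by (intro card_image inj_on_subset[OF inj_on_circ[OF assms]]) auto
  also have "\<dots> = 2 * k" by simp
  finally show ?thesis .
qed

lemma finite_nbrs: "finite (circ_nbrs n k v)"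
  by (simp add: circ_nbrs_def)

lemma circ_nbrs_sym:
  assumes "n > 0" "v \<in> {1..n}" "u \<in> circ_nbrs n k v"
  shows "v \<in> circ_nbrs n k u"
proof -
  obtain j where j: "j \<in> {- int k..int k} - {0}" "u = circ_shift n v j" using assms(3)
    unfolding circ_nbrs_def by blast
  have "v = circ_shift n u (- j)" using assms j by (simp add: circ_shift_circ circ_shift_0)
  thus ?thesis using j(1) unfolding circ_nbrs_def by (intro image_eqI[of _ _ "- j"]) auto
qed

lemma circ_nbrs_irrefl:
  assumes "2 * k < n" "v \<in> {1..n}"
  shows "v \<notin> circ_nbrs n k v"
proof
  assume "v \<in> circ_nbrs n k v"
  then obtain j where j: "j \<in> {- int k..int k} - {0}" "v = circ_shift n v j"
    unfolding circ_nbrs_def by blast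
  hence "circ_shift n v j = circ_shift n v 0" using circ_shift_0[OF assms(2)] by simp
  from inj_onD[OF inj_on_circ[OF assms(1)] this] j(1) show False by auto
qed

text \<open>The vertices on no edge of block \<open>k + 1\<close>.\<close>

definition untouched :: "nat \<Rightarrow> nat \<Rightarrow> (nat \<times> nat) list \<Rightarrow> nat set" where
  "untouched n k h = {1..n} - (fst ` set (drop (k * n) h) \<union> snd ` set (drop (k * n) h))"

definition circ_non_nbrs :: "nat \<Rightarrow> nat \<Rightarrow> nat \<Rightarrow> nat set" where
  "circ_non_nbrs n k v = {1..n} - insert v (circ_nbrs n k v)"

text \<open>\<open>length h div n\<close> is the number of completed blocks, hence the
  \<open>+ 1\<close>. Later choices are non-neighbours whenever one exists, so that the new edge is
  not parallel to a circulant one. The value \<open>1\<close> only keeps the function in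
  \<open>strategies\<close>; it does not occur in late rounds when
  \<open>2 * k + 1 < n\<close>.\<close>

definition circulant_strategy :: "nat \<Rightarrow> nat \<Rightarrow> strategy" where
  "circulant_strategy n k h v =
     (if length h < k * n then circ_shift n v (int (length h div n) + 1)
      else if circ_non_nbrs n k v \<inter> untouched n k h \<noteq> {} then SOME u. u \<in> circ_non_nbrs n k v \<inter>
          untouched n k h
      else if circ_non_nbrs n k v \<noteq> {} then SOME u. u \<in> circ_non_nbrs n k v
      else 1)"

lemma circulant_strategy_late:
  assumes "k * n \<le> length h" "circ_non_nbrs n k v \<noteq> {}"
  shows "circulant_strategy n k h v \<in> circ_non_nbrs n k v"
    and "circ_non_nbrs n k v \<inter> untouched n k h \<noteq> {} \<Longrightarrow> circulant_strategy n k h v \<in> untouched n k h"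
proof -
  have *: "(SOME u. u \<in> A) \<in> A" if "A \<noteq> {}" for A :: "nat set"
    using that by (simp add: some_in_eq)
  show "circulant_strategy n k h v \<in> circ_non_nbrs n k v"
    using assms *[of "circ_non_nbrs n k v"] *[of "circ_non_nbrs n k v \<inter> untouched n k h"]
    by (auto simp: circulant_strategy_def)
  show "circulant_strategy n k h v \<in> untouched n k h" if "circ_non_nbrs n k v \<inter> untouched n k h \<noteq>
      {}"
    using assms *[OF that] that by (auto simp: circulant_strategy_def)
qed

lemma circulant_strategy_in:
  assumes "n > 0"
  shows "circulant_strategy n k \<in> strategies n"
proof -
  have "circulant_strategy n k h v \<in> {1..n}" for h v
  proof (cases "length h < k * n \<or> circ_non_nbrs n k v = {}")
    case True
    thus ?thesis using assms circ_shift_in[OF assms]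
      by (auto simp: circulant_strategy_def simp del: atLeastAtMost_iff) auto
  next
    case False
    thus ?thesis using circulant_strategy_late(1)[of k n h v] by (auto simp: circ_non_nbrs_def)
  qed
  thus ?thesis by (simp add: strategies_def)
qed

lemma circ_non_nbrs_nonempty:
  assumes "2 * k + 1 < n"
  shows "circ_non_nbrs n k v \<noteq> {}"
proof
  assume "circ_non_nbrs n k v = {}"
  hence "{1..n} \<subseteq> insert v (circ_nbrs n k v)" by (auto simp: circ_non_nbrs_def)
  hence "card {1..n} \<le> card (insert v (circ_nbrs n k v))"
    by (intro card_mono) (auto simp: finite_nbrs)
  also have "\<dots> \<le> Suc (2 * k)" using card_insert_le_m1[of "Suc (2 * k)" "circ_nbrs n k v" v] assms
    by (simp add: card_nbrs)
  finally show False using assms by simp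
qed

text \<open>The witness is the largest simple graph inside \<open>G\<close>, with loops discarded;
  the edges \<open>{w, v}\<close> for distinct \<open>w\<close> are distinct.\<close>

lemma min_degree_family_witness:
  assumes "n > 0"
    and W: "\<And>v. v \<in> {1..n} \<Longrightarrow> \<exists>W. W \<subseteq> {1..n} - {v} \<and> d \<le> card W \<and> (\<forall>w\<in>W. {w, v} \<in> G)"
  shows "\<exists>E\<in>iso_closure n (min_degree_family d n). E \<subseteq> G"
proof -
  define E where "E = {e \<in> G. e \<subseteq> {1..n} \<and> card e = 2}"
  have sE: "simple_graph n E" by (auto simp: simple_graph_def E_def)
  have fin: "finite E" by (rule finite_subset[of _ "Pow {1..n}"]) (auto simp: E_def)
  have deg: "d \<le> vertex_degree E v" if v: "v \<in> {1..n}" for v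
  proof -
    obtain W where W: "W \<subseteq> {1..n} - {v}" "d \<le> card W" "\<And>w. w \<in> W \<Longrightarrow> {w, v} \<in> G"
      using W[OF v] by blast
    have "card W = card ((\<lambda>w. {w, v}) ` W)"
      using W(1) by (intro card_image[symmetric] inj_onI) (auto simp: doubleton_eq_iff)
    also have "\<dots> \<le> vertex_degree E v" unfolding vertex_degree_def
    proof (rule card_mono)
      show "finite {e \<in> E. v \<in> e}" using fin by simp
      show "(\<lambda>w. {w, v}) ` W \<subseteq> {e \<in> E. v \<in> e}" using W(1,3) v by (fastforce simp: E_def card_2_iff)
    qed
    finally show ?thesis using W(2) by simp
  qed
  have "d \<le> min_degree n E" unfolding min_degree_def
    using deg \<open>n > 0\<close> by (intro Min.boundedI) auto
  hence "E \<in> min_degree_family d n" using sE by (simp add: min_degree_family_def)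
  hence "E \<in> iso_closure n (min_degree_family d n)" unfolding iso_closure_def
    using sE by (auto intro!: bexI[of _ E] exI[of _ id])
  moreover have "E \<subseteq> G" by (auto simp: E_def)
  ultimately show ?thesis by blast
qed

text \<open>Block \<open>l + 1\<close> offers every vertex once, whatever its permutation;
  \<open>v\<close> appears there after \<open>l * n + r\<close> earlier rounds.\<close>

lemma circulant_pair_in_history:
  assumes \<pi>: "\<pi> \<in> space (perm_process n)" and "l < k" "v \<in> {1..n}" "k * n \<le> m"
  shows "(circ_shift n v (int (Suc l)), v) \<in> set (history n \<pi> (circulant_strategy n k) m)"
proof -
  have p: "\<pi> (Suc l) permutes {1..n}" using perm_process_permutes[OF \<pi>] by simp
  obtain r' where r': "r' \<in> {1..n}" "\<pi> (Suc l) r' = v"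
    using permutes_image[OF p] assms(3) by (metis imageE)
  define r where "r = r' - 1"
  have r: "r < n" "\<pi> (Suc l) (Suc r) = v" using r' by (auto simp: r_def)
  define i where "i = l * n + r"
  have "Suc l * n \<le> k * n" using \<open>l < k\<close> by (intro mult_le_mono1) simp
  hence i: "i < k * n" using r(1) by (simp add: i_def)
  have "offered n \<pi> (Suc i) = v" unfolding i_def using r by (simp add: offered_block)
  moreover have "i div n = l" using r(1) by (simp add: i_def)
  ultimately show ?thesis
    using i \<open>k * n \<le> m\<close> unfolding set_history
      by (intro image_eqI[of _ _ i]) (auto simp: circulant_strategy_def add.commute)
qed

lemma circulant_edge:
  assumes \<pi>: "\<pi> \<in> space (perm_process n)" and v: "v \<in> {1..n}" and u: "u \<in> circ_nbrs n k v" and "k *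
      n \<le> m"
  shows "{u, v} \<in> set_mset (builder_graph n \<pi> (circulant_strategy n k) m)"
proof -
  have n: "n > 0" using v by simp
  obtain j where j: "j \<in> {- int k..int k}" "j \<noteq> 0" "u = circ_shift n v j" using u
    unfolding circ_nbrs_def by blast
  show ?thesis
  proof (cases "j > 0")
    case True
    define l where "l = nat j - 1"
    have l: "l < k" "j = int (Suc l)" using True j by (auto simp: l_def)
    show ?thesis using circulant_pair_in_history[OF \<pi> l(1) v \<open>k * n \<le> m\<close>] j(3) l(2)
      by (force simp: set_mset_builder_graph)
  next
    case False
    define l where "l = nat (- j) - 1"
    have l: "l < k" "- j = int (Suc l)" using False j by (auto simp: l_def)
    \<comment> \<open>For a negative offset the edge was added when \<open>u\<close> was offered and
      \<open>v\<close> chosen.\<close>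
    have "v = circ_shift n u (- j)" using j v n by (simp add: circ_shift_circ circ_shift_0)
    moreover have "u \<in> {1..n}" using j(3) circ_shift_in[OF n] by simp
    ultimately have "(v, u) \<in> set (history n \<pi> (circulant_strategy n k) m)"
      using circulant_pair_in_history[OF \<pi> l(1) _ \<open>k * n \<le> m\<close>, of u] l(2) by simp
    thus ?thesis by (force simp: set_mset_builder_graph)
  qed
qed

lemma success_prob_even:
  assumes "2 * k < n"
  shows "success_prob (iso_closure n (min_degree_family (2 * k) n)) n (k * n) (circulant_strategy n
      k) = 1"
proof -
  interpret prob_space "perm_process n" by (rule prob_space_perm_process)
  let ?F = "iso_closure n (min_degree_family (2 * k) n)"
  have "hitting_time ?F n (circulant_strategy n k) \<pi> \<le> enat (k * n)"
    if \<pi>: "\<pi> \<in> space (perm_process n)" for \<pi>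
    unfolding hitting_time_le_iff_final
  proof (rule min_degree_family_witness)
    fix v assume v: "v \<in> {1..n}"
    show "\<exists>W. W \<subseteq> {1..n} - {v} \<and> 2 * k \<le> card W \<and>
            (\<forall>w\<in>W. {w, v} \<in> set_mset (builder_graph n \<pi> (circulant_strategy n k) (k * n)))"
      using circ_nbrs_subset[of n k v] circ_nbrs_irrefl[OF assms v] card_nbrs[OF assms, of v]
          circulant_edge[OF \<pi> v] assms
      by (intro exI[of _ "circ_nbrs n k v"]) auto
  qed (use assms in simp)
  hence "{\<pi> \<in> space (perm_process n). hitting_time ?F n (circulant_strategy n k) \<pi>
      \<le> enat (k * n)} = space (perm_process n)"
    by blast
  thus ?thesis unfolding success_prob_def by (simp only: prob_space)
qed

section \<open>Block \<open>k + 1\<close> under the circulant strategy\<close>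

context
  fixes n k :: nat and \<pi> :: "nat \<Rightarrow> nat \<Rightarrow> nat"
  assumes kn: "2 * k + 1 < n" and \<pi>: "\<pi> \<in> space (perm_process n)"
begin

private abbreviation "q \<equiv> \<pi> (Suc k)"
private abbreviation "hist \<equiv> \<lambda>i. history n \<pi> (circulant_strategy n k) (k * n + i)"
private abbreviation "V \<equiv> \<lambda>i. untouched n k (hist i)"
private abbreviation "choice \<equiv> \<lambda>i. circulant_strategy n k (hist i) (q (Suc i))"

lemma last_block_permutes: "q permutes {1..n}" using perm_process_permutes[OF \<pi>] by simp

lemma last_block_in: "i < n \<Longrightarrow> q (Suc i) \<in> {1..n}"
  using permutes_in_image[OF last_block_permutes] by simp

lemma untouched_0: "V 0 = {1..n}"
  by (simp add: untouched_def)

lemma untouched_Suc: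
  assumes "i < n"
  shows "V (Suc i) = V i - {choice i, q (Suc i)}"
  using assms by (auto simp: untouched_def offered_block)

lemma choice_in: "choice i \<in> circ_non_nbrs n k (q (Suc i))"
  by (rule circulant_strategy_late(1)) (auto simp: circ_non_nbrs_nonempty[OF kn])

lemma untouched_antimono: "i \<le> j \<Longrightarrow> j \<le> n \<Longrightarrow> V j \<subseteq> V i"
proof (induction j)
  case (Suc j)
  thus ?case using untouched_Suc[of j] by (cases "i = Suc j") auto
qed simp

lemma untouched_unoffered: "i \<le> n \<Longrightarrow> V i \<subseteq> {1..n} - q ` {1..i}"
proof (induction i)
  case 0 thus ?case by (auto simp: untouched_def)
next
  case (Suc i)
  thus ?case using untouched_Suc[of i] by (auto simp: atLeastAtMostSuc_conv)
qed

text \<open>Edges of this block join circulant non-neighbours, a symmetric relation. So a touched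
  vertex, offered or chosen, has an edge beyond its \<open>2 k\<close> circulant ones.\<close>

lemma touched_edge:
  assumes "s \<le> n" "w \<in> {1..n} - V s"
  shows "\<exists>x\<in>circ_non_nbrs n k w. {x, w} \<in> set_mset (builder_graph n \<pi> (circulant_strategy n k) (k *
      n + s))"
proof -
  have "\<exists>i<s. w \<in> {choice i, q (Suc i)}" using assms
  proof (induction s)
    case 0 thus ?case using untouched_0 by blast
  next
    case (Suc s) thus ?case using untouched_Suc[of s] less_Suc_eq by auto
  qed
  then obtain i where i: "i < s" "w \<in> {choice i, q (Suc i)}" by blast
  have "(choice i, q (Suc i)) \<in> set (hist s)"
    unfolding set_history using i assms
      by (intro image_eqI[of _ _ "k * n + i"]) (auto simp: offered_block)
  hence e: "{choice i, q (Suc i)} \<in> set_mset (builder_graph n \<pi> (circulant_strategy n k) (k * n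
      + s))"
    by (force simp: set_mset_builder_graph)
  have q: "q (Suc i) \<in> {1..n}" using last_block_in i assms by simp
  show ?thesis
  proof (cases "w = q (Suc i)")
    case True
    thus ?thesis using choice_in[of i] e by blast
  next
    case False
    hence w: "w = choice i" using i by simp
    have "q (Suc i) \<in> circ_non_nbrs n k w"
      using choice_in[of i] q circ_nbrs_sym[of n w "q (Suc i)" k] assms(2) kn False
      unfolding w circ_non_nbrs_def by auto
    thus ?thesis using e w by (metis insert_commute)
  qed
qed

lemma hit_if_all_touched:
  assumes "s \<le> n" "V s = {}"
  shows "hitting_time (iso_closure n (min_degree_family (2 * k + 1) n)) n (circulant_strategy n k) \<pi>
      \<le> enat (k * n + s)"
  unfolding hitting_time_le_iff_final
proof (rule min_degree_family_witness)
  show "n > 0" using kn by simp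
  have kn': "2 * k < n" using kn by simp
  fix v assume v: "v \<in> {1..n}"
  then obtain x where x: "x \<in> circ_non_nbrs n k v" "{x, v} \<in> set_mset (builder_graph n \<pi>
      (circulant_strategy n k) (k * n + s))"
    using touched_edge[OF assms(1), of v] assms(2) by auto
  have "card (insert x (circ_nbrs n k v)) = 2 * k + 1"
    using x(1) by (simp add: circ_non_nbrs_def finite_nbrs card_nbrs[OF kn'])
  thus "\<exists>W. W \<subseteq> {1..n} - {v} \<and> 2 * k + 1 \<le> card W \<and>
          (\<forall>w\<in>W. {w, v} \<in> set_mset (builder_graph n \<pi> (circulant_strategy n k) (k * n + s)))"
    using x circ_nbrs_subset[OF \<open>n > 0\<close>, of k v] circ_nbrs_irrefl[OF kn' v] circulant_edge[OF \<pi> v,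
        of _ k "k * n + s"]
    by (intro exI[of _ "insert x (circ_nbrs n k v)"]) (auto simp: circ_non_nbrs_def)
qed

text \<open>Index \<open>i\<close> stands for round \<open>i + 1\<close> of the block, in which the
  choice itself touches a new vertex. The set is not cut off at \<open>n\<close>; it is intersected
  with \<open>{..<s}\<close> where it is used.\<close>

definition matched :: "nat set" where
  "matched = {i. circ_non_nbrs n k (q (Suc i)) \<inter> V i \<noteq> {}}"

text \<open>Counterpart of \<open>deficiency_martingale_bound\<close> with the inequality reversed.
  The number of untouched vertices starts at \<open>n\<close>; since \<open>P i\<close> is the
  untouched set itself, the conditional probability of offering one is exact.\<close>

lemma untouched_martingale_bound:
  assumes "s < n" and P: "\<And>i. i < s \<Longrightarrow> P i q = V i"
  shows "real (card (V s)) / real (n - s)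
           \<le> 1 - (\<Sum>i<s. indicat_real matched i / real (n - i - 1)) - block_martingale n P q s"
  using assms
proof (induction s)
  case 0
  thus ?case using untouched_0 by (simp add: block_martingale_def)
next
  case (Suc s)
  define X where "X i = real (card (V i))" for i
  define c where "c = 1 / real (n - s - 1)"
  define B where "B = indicat_real (V s) (q (Suc s))"
  define A where "A = indicat_real matched s"
  have ns: "real (n - s) = real (n - s - 1) + 1" "real (n - s - 1) > 0" using Suc.prems(1) by auto
  have IH: "X s / real (n - s)
      \<le> 1 - (\<Sum>i<s. indicat_real matched i / real (n - i - 1)) - block_martingale n P q s"
    unfolding X_def using Suc by simp
  have "X (Suc s) + B + A \<le> X s"
  proof -
    have fin: "finite (V s)" by (simp add: untouched_def)
    \<comment> \<open>The vertices that become touched. The two candidates are distinct, so the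
      cardinality is a sum of two indicators.\<close>
    let ?R = "{choice s, q (Suc s)} \<inter> V s"
    have "card (V (Suc s)) = card (V s) - card ?R"
      unfolding untouched_Suc[OF Suc_lessD[OF Suc.prems(1)]]
      by (subst card_Diff_subset_Int) (auto simp: Int_commute)
    moreover have "card ?R \<le> card (V s)" by (intro card_mono fin) auto
    ultimately have "X (Suc s) + real (card ?R) = X s" by (simp add: X_def)
    moreover have "B + A \<le> real (card ?R)"
    proof -
      have ne: "choice s \<noteq> q (Suc s)" using choice_in[of s] by (auto simp: circ_non_nbrs_def)
      have m: "choice s \<in> V s" if "s \<in> matched"
        using that unfolding matched_def
        by (intro circulant_strategy_late(2)) (auto simp: circ_non_nbrs_nonempty[OF kn])
      have "real (card ?R) = indicat_real (V s) (choice s) + B"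
        using ne by (cases "choice s \<in> V s"; cases "q (Suc s) \<in> V s") (simp_all add: B_def)
      thus ?thesis using m by (cases "s \<in> matched") (simp_all add: A_def)
    qed
    ultimately show ?thesis by simp
  qed
  hence "c * X (Suc s) \<le> c * (X s - B - A)" by (intro mult_left_mono) (auto simp: c_def)
  moreover have "c * X s - c * (X s / real (n - s)) = X s / real (n - s)"
    unfolding c_def ns(1) using ns(2) by (simp add: divide_simps) (simp add: algebra_simps)
  moreover have "block_martingale n P q (Suc s) = block_martingale n P q s
      + c * (B - X s / real (n - s))"
    using Suc.prems(2)[of s] by (simp add: block_martingale_def B_def X_def c_def)
  moreover have "c * X (Suc s) = X (Suc s) / real (n - Suc s)" by (simp add: c_def)
  moreover define E where "E = X s / real (n - s)"
  moreover define F where "F = X (Suc s) / real (n - Suc s)"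
  moreover define G where "G = (\<Sum>i<s. indicat_real matched i / real (n - i - 1))"
  ultimately have "F \<le> 1 - (G + c * A) - block_martingale n P q (Suc s)"
    using IH unfolding right_diff_distrib E_def[symmetric] F_def[symmetric] G_def[symmetric] by
        linarith
  moreover have "c * A = indicat_real matched s / real (n - s - 1)" by (simp add: c_def A_def)
  ultimately show ?case by (simp only: sum.lessThan_Suc F_def G_def X_def)
qed

text \<open>A vertex \<open>u\<close> untouched after \<open>s\<close> rounds was available in every
  earlier one and was never offered. In an unmatched round it must then be a circulant neighbour of
  the offered vertex; the offers are distinct and \<open>u\<close> has \<open>2 k\<close>
  neighbours.\<close>

lemma card_unmatched_le:
  assumes "s \<le> n" "V s \<noteq> {}"
  shows "card ({..<s} - matched) \<le> 2 * k"
proof -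
  obtain u where u: "u \<in> V s" using assms(2) by blast
  have u_in: "u \<in> {1..n}" using u by (auto simp: untouched_def)
  have kn': "2 * k < n" "0 < n" using kn by auto
  have "(\<lambda>i. q (Suc i)) ` ({..<s} - matched) \<subseteq> circ_nbrs n k u"
  proof safe
    fix i assume i: "i < s" "i \<notin> matched"
    have "u \<in> V (Suc i)" using untouched_antimono[of "Suc i" s] i assms u by auto
    hence "u \<in> V i" "u \<noteq> q (Suc i)" using untouched_Suc[of i] i assms by auto
    hence "u \<in> circ_nbrs n k (q (Suc i))" using i(2) u_in
      by (auto simp: matched_def circ_non_nbrs_def)
    thus "q (Suc i) \<in> circ_nbrs n k u" using circ_nbrs_sym[OF kn'(2) last_block_in] i assms by auto
  qed
  hence "card ((\<lambda>i. q (Suc i)) ` ({..<s} - matched)) \<le> card (circ_nbrs n k u)"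
    by (intro card_mono finite_nbrs)
  moreover have "inj_on (\<lambda>i. q (Suc i)) ({..<s} - matched)"
    using permutes_inj[OF last_block_permutes] by (intro inj_onI) (auto dest: injD)
  ultimately show ?thesis by (simp add: card_image card_nbrs[OF kn'(1)])
qed

end

section \<open>Upper bound for odd degree\<close>

text \<open>For increasing weights an initial segment is the cheapest index set of its size: the
  worst case wastes the last rounds.\<close>

lemma sum_lessThan_card_le:
  fixes c :: "nat \<Rightarrow> real"
  assumes "finite I" "I \<subseteq> {..<s}" "\<And>i j. i \<le> j \<Longrightarrow> j < s \<Longrightarrow> c i \<le> c j"
  shows "(\<Sum>i<card I. c i) \<le> sum c I"
  using assms(1,2)
proof (induction I rule: finite_linorder_max_induct)
  case (insert b A)
  \<comment> \<open>\<open>b\<close> exceeds every element of \<open>A\<close>, so it is at least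
    \<open>card A\<close>.\<close>
  have "card A \<le> card {..<b}" using insert by (intro card_mono) auto
  hence "c (card A) \<le> c b" using insert assms(3) by simp
  moreover have "b \<notin> A" using insert by blast
  ultimately show ?case using insert by simp
qed simp

text \<open>Failure leaves an untouched vertex, hence at most \<open>2 k\<close> unmatched rounds.
  The matched weights then sum to at least \<open>a + 1\<close>, so the martingale must deviate by
  \<open>a\<close>.\<close>

lemma success_prob_odd_ge:
  fixes n k s :: nat
  defines "a \<equiv> (\<Sum>i<s - 2 * k. 1 / real (n - i - 1)) - 1"
  assumes kn: "2 * k + 1 < n" and "s < n" "a > 0"
  shows "1 - (\<Sum>i<s. 1 / (real (n - i - 1))\<^sup>2) / a\<^sup>2
           \<le> success_prob (iso_closure n (min_degree_family (2 * k + 1) n)) n (k * n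
               + s) (circulant_strategy n k)"
proof -
  let ?F = "iso_closure n (min_degree_family (2 * k + 1) n)"
  let ?S = "circulant_strategy n k"
  let ?A = "{\<pi> \<in> space (perm_process n). hitting_time ?F n ?S \<pi> \<le> enat (k * n + s)}"
  let ?v = "\<Sum>i<s. 1 / (real (n - i - 1))\<^sup>2"
  interpret prob_space "perm_process n" by (rule prob_space_perm_process)
  have A: "?A \<in> sets (perm_process n)" using \<open>s < n\<close> by (intro success_event_measurable) auto
  have "measure (perm_process n) (space (perm_process n) - ?A) \<le> ?v / a\<^sup>2"
  proof (rule perm_process_resample[of _ _ "Suc k"])
    show "space (perm_process n) - ?A \<in> sets (perm_process n)" using A by (rule sets.compl_sets)
    show "0 \<le> ?v / a\<^sup>2" by (intro divide_nonneg_nonneg sum_nonneg) auto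
    fix \<rho> assume "\<rho> \<in> space (perm_process n)"
    \<comment> \<open>The intersection yields the inclusion in \<open>predictable\<close> for
      arbitrary \<open>q\<close>; on the processes considered it removes nothing, by
      \<open>untouched_unoffered\<close>.\<close>
    define P where "P i q = untouched n k (history n (\<rho>(Suc k := q)) ?S (k * n
        + i)) \<inter> ({1..n} - q ` {1..i})"
      for i and q :: "nat \<Rightarrow> nat"
    have pred: "predictable n P"
    proof -
      have "P i p = P i q" if "i < n" "\<forall>j\<in>{1..i}. p j = q j" for i p q
      proof -
        have "p ` {1..i} = q ` {1..i}" using that by (intro image_cong) auto
        thus ?thesis using history_resample_cong[of i n p q \<rho> k ?S] that by (simp add: P_def)
      qed
      moreover have "P i p \<subseteq> {1..n} - p ` {1..i}" for i p unfolding P_def by blast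
      ultimately show ?thesis unfolding predictable_def by blast
    qed
    have "\<bar>block_martingale n P q s\<bar> \<ge> a" if q: "\<rho>(Suc k := q) \<in> space (perm_process n) - ?A" for q
    proof -
      define \<pi> where "\<pi> = \<rho>(Suc k := q)"
      have \<pi>: "\<pi> \<in> space (perm_process n)" using q by (simp add: \<pi>_def)
      have \<pi>q: "\<pi> (Suc k) = q" by (simp add: \<pi>_def)
      let ?V = "\<lambda>i. untouched n k (history n \<pi> ?S (k * n + i))"
      let ?m = "matched n k \<pi>"
      have ne: "?V s \<noteq> {}"
        using hit_if_all_touched[OF kn \<pi>, of s] \<open>s < n\<close> q by (auto simp: \<pi>_def)
      have P: "P i (\<pi> (Suc k)) = ?V i" if "i < s" for i
      proof -
        have "?V i \<subseteq> {1..n} - q ` {1..i}"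
          using untouched_unoffered[OF kn \<pi>, of i] that \<open>s < n\<close> by (simp only: \<pi>q)
        thus ?thesis by (simp only: \<pi>q P_def \<pi>_def[symmetric]) blast
      qed
      have "0 \<le> real (card (?V s)) / real (n - s)" by simp
      also have "\<dots> \<le> 1 - (\<Sum>i<s. indicat_real ?m i / real (n - i - 1)) - block_martingale n P q s"
        using untouched_martingale_bound[where P = P, OF kn \<pi> \<open>s < n\<close> P] by (simp only: \<pi>q)
      finally have 1: "(\<Sum>i<s. indicat_real ?m i / real (n - i - 1)) - 1
          \<le> - block_martingale n P q s" by simp
      have "card ({..<s} - ?m) \<le> 2 * k"
        using card_unmatched_le[OF kn \<pi> less_imp_le[OF \<open>s < n\<close>] ne] .
      moreover have "card ({..<s} - ?m) = s - card ({..<s} \<inter> ?m)"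
        by (subst card_Diff_subset_Int) auto
      ultimately have "s - 2 * k \<le> card ({..<s} \<inter> ?m)" by simp
      hence "(\<Sum>i<s - 2 * k. 1 / real (n - i - 1)) \<le> (\<Sum>i<card ({..<s} \<inter> ?m). 1 / real (n - i - 1))"
        by (intro sum_mono2) auto
      also have "\<dots> \<le> (\<Sum>i\<in>{..<s} \<inter> ?m. 1 / real (n - i - 1))"
        using \<open>s < n\<close> by (intro sum_lessThan_card_le[of _ s]) (auto intro!: divide_left_mono)
      also have "\<dots> = (\<Sum>i<s. indicat_real ?m i / real (n - i - 1))"
        by (rule sum.mono_neutral_cong_left) (auto simp: indicator_def)
      finally show ?thesis using 1 by (simp add: a_def)
    qed
    hence "card {p. p permutes {1..n} \<and> \<rho>(Suc k := p) \<in> space (perm_process n) - ?A}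
            \<le> card {p. p permutes {1..n} \<and> \<bar>block_martingale n P p s\<bar> \<ge> a}"
      by (intro card_mono) (auto intro: finite_subset[OF _ finite_permutations[of "{1..n}"]])
    also have "real \<dots> \<le> ?v / a\<^sup>2 * fact n"
      by (rule block_martingale_chebyshev[OF pred \<open>s < n\<close> \<open>a > 0\<close>])
    finally show "real (card {p. p permutes {1..n} \<and> \<rho>(Suc k := p) \<in> space (perm_process n) - ?A})
                  \<le> ?v / a\<^sup>2 * fact n" by simp
  qed simp
  thus ?thesis using prob_compl[OF A] by (simp add: success_prob_def)
qed

subsection \<open>Asymptotics\<close>

text \<open>Telescope \<open>1 / m \<le> ln m - ln (m - 1)\<close>; the leading
  \<open>ln (n - 1)\<close> is relaxed to \<open>ln n\<close>.\<close>

lemma sum_inverse_le_ln: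
  assumes "s + 1 < n"
  shows "(\<Sum>i<s. 1 / real (n - i - 1)) \<le> ln (real n) - ln (real (n - s - 1))"
  using assms
proof (induction s)
  case 0
  thus ?case by simp
next
  case (Suc s)
  have "ln (real (n - Suc s - 1)) - ln (real (n - s - 1))
      \<le> (real (n - Suc s - 1) - real (n - s - 1)) / real (n - s - 1)"
    using Suc.prems by (intro ln_diff_le) auto
  also have "real (n - Suc s - 1) - real (n - s - 1) = - 1" using Suc.prems by auto
  finally show ?case using Suc by simp
qed

text \<open>Telescope \<open>ln (m + 1) - ln m \<le> 1 / m\<close>.\<close>

lemma ln_le_sum_inverse:
  assumes "s < n"
  shows "ln (real n) - ln (real (n - s)) \<le> (\<Sum>i<s. 1 / real (n - i - 1))"
  using assms
proof (induction s)
  case (Suc s)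
  have "ln (real (n - s)) - ln (real (n - s - 1))
      \<le> (real (n - s) - real (n - s - 1)) / real (n - s - 1)"
    using Suc.prems by (intro ln_diff_le) auto
  also have "real (n - s) - real (n - s - 1) = 1" using Suc.prems by auto
  finally show ?case using Suc by simp
qed simp

text \<open>While a fraction \<open>1 / C\<close> of the block remains, each of at most
  \<open>n\<close> terms is at most \<open>(C / n)\<^sup>2\<close>.\<close>

lemma sum_inverse_squares_le:
  assumes "s < n" "real n \<le> C * real (n - s)"
  shows "(\<Sum>i<s. 1 / (real (n - i - 1))\<^sup>2) \<le> C\<^sup>2 / real n"
proof -
  have n: "real n > 0" "real (n - s) > 0" using assms(1) by auto
  have "(\<Sum>i<s. 1 / (real (n - i - 1))\<^sup>2) \<le> (\<Sum>i<s. 1 / (real (n - s))\<^sup>2)"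
    using assms(1) by (intro sum_mono divide_left_mono power_mono) auto
  also have "\<dots> = real s / (real (n - s))\<^sup>2" by simp
  also have "\<dots> \<le> real n / (real (n - s))\<^sup>2" using assms(1) by (intro divide_right_mono) auto
  also have "\<dots> \<le> C\<^sup>2 / real n"
  proof -
    define D where "D = real (n - s)"
    have "(real n)\<^sup>2 \<le> C\<^sup>2 * D\<^sup>2"
      using power_mono[OF assms(2), of 2] by (simp add: D_def power_mult_distrib)
    moreover have "D > 0" using n(2) by (simp add: D_def)
    ultimately show ?thesis
      unfolding D_def[symmetric] using n(1) by (simp add: divide_simps) (simp add: power2_eq_square)
  qed
  finally show ?thesis .
qed

text \<open>Variance \<open>C\<^sup>2 / N\<close> against margin \<open>(g - 1) / N\<close>: the
  quotient is small once \<open>g\<close> is large compared with \<open>sqrt N\<close>. The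
  \<open>- 1\<close> leaves room for rounding.\<close>

lemma chebyshev_ratio_le:
  fixes a g v C N :: real
  assumes "v \<le> C\<^sup>2 / N" "(g - 1) / N \<le> a" "g > 1" "N > 0"
  shows "v / a\<^sup>2 \<le> C\<^sup>2 * N / (g - 1)\<^sup>2"
proof -
  have pos: "(g - 1) / N > 0" using assms by simp
  hence "a > 0" using assms(2) by linarith
  have "v / a\<^sup>2 \<le> (C\<^sup>2 / N) / a\<^sup>2" using assms(1) by (intro divide_right_mono) auto
  also have "\<dots> \<le> (C\<^sup>2 / N) / ((g - 1) / N)\<^sup>2"
    using assms pos \<open>a > 0\<close> by (intro divide_left_mono power_mono mult_pos_pos zero_less_power) auto
  also have "\<dots> = C\<^sup>2 * N / (g - 1)\<^sup>2" using assms(4) by (simp add: field_simps power2_eq_square)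
  finally show ?thesis .
qed

lemma third_le_div_exp1: "real n / 3 \<le> real n / exp 1"
  using exp_le by (intro divide_left_mono) auto

lemma success_prob_odd_early:
  fixes n k m :: nat and g :: real
  assumes m: "real m < (real k + 1 - 1 / exp 1) * real n - g" and g: "g \<ge> 2" and n: "n > 0"
  shows "success_prob (iso_closure n (min_degree_family (2 * k + 1) n)) n m S
      \<le> 9 * real n / (g - 1)\<^sup>2"
proof (cases "m \<le> k * n")
  case True
  have "success_prob (iso_closure n (min_degree_family (2 * k + 1) n)) n m S = 0"
    using True n by (intro success_prob_few_rounds) (simp add: algebra_simps)
  thus ?thesis by simp
next
  case False
  then obtain s where s: "m = k * n + s" using le_Suc_ex by (metis nat_le_linear)
  \<comment> \<open>The number of unoffered vertices at which \<open>ln n - ln Y\<close> equals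
    \<open>1\<close>, that is, at which the drift has used up the initial value.\<close>
  define Y where "Y = real n / exp 1"
  have Y: "Y > 0" "real n / 3 \<le> Y" using n third_le_div_exp1 by (auto simp: Y_def)
  have sY: "real s < real n - Y - g" using m by (simp add: s Y_def algebra_simps)
  hence sn: "s + 1 < n" using Y g by linarith
  define y where "y = real (n - s - 1)"
  have y: "y = real n - real s - 1" using sn by (simp add: y_def)
  have y_gt: "y > Y + g - 1" using sY y by linarith
  define a where "a = 1 - (\<Sum>i<s. 1 / real (n - i - 1))"
  have lnY: "ln Y = ln (real n) - 1" using n by (simp add: Y_def ln_div)
  have "ln Y - ln y \<le> (Y - y) / y" using Y y_gt g by (intro ln_diff_le) auto
  moreover have "(g - 1) / real n \<le> (y - Y) / y"
    using y_gt g Y y by (intro frac_le) auto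
  moreover have "(Y - y) / y = - ((y - Y) / y)" by (simp add: diff_divide_distrib)
  ultimately have a: "(g - 1) / real n \<le> a"
    using sum_inverse_le_ln[OF sn] lnY unfolding a_def y_def by linarith
  moreover have "0 < (g - 1) / real n" using g n by simp
  ultimately have a_pos: "a > 0" by linarith
  have "success_prob (iso_closure n (min_degree_family (2 * k + 1) n)) n m S
      \<le> (\<Sum>i<s. 1 / (real (n - i - 1))\<^sup>2) / a\<^sup>2"
    unfolding s a_def using sn a_pos by (intro success_prob_odd_le) (auto simp: a_def)
  also have "\<dots> \<le> 3\<^sup>2 * real n / (g - 1)\<^sup>2"
  proof (rule chebyshev_ratio_le[OF _ a])
    \<comment> \<open>At least \<open>Y \<ge> n / 3\<close> vertices remain, so
      \<open>C = 3\<close>.\<close>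
    show "(\<Sum>i<s. 1 / (real (n - i - 1))\<^sup>2) \<le> 3\<^sup>2 / real n"
      using sn sY Y g by (intro sum_inverse_squares_le) auto
  qed (use g n in auto)
  finally show ?thesis by simp
qed

lemma success_prob_odd_late:
  fixes n k :: nat and g :: real
  assumes g: "2 \<le> g" "g \<le> real n / 12" and k: "2 * k + 1 < n" "real (2 * k) \<le> real n / 8"
  shows "\<exists>m. real m \<le> (real k + 1 - 1 / exp 1) * real n + g + 2 * real k \<and>
             1 - 64 * real n / (g - 1)\<^sup>2
               \<le> success_prob (iso_closure n (min_degree_family (2 * k
                   + 1) n)) n m (circulant_strategy n k)"
proof -
  define Y where "Y = real n / exp 1"
  have n: "n > 0" using k by simp
  have Y: "Y > 0" "real n / 3 \<le> Y" "Y \<le> real n"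
    using n third_le_div_exp1 by (auto simp: Y_def field_simps)
  \<comment> \<open>The extra \<open>2 k\<close> rounds pay for the unmatched ones; the floor costs
    less than one round, hence \<open>g - 1\<close> below.\<close>
  define s where "s = nat \<lfloor>real n - Y + g + 2 * real k\<rfloor>"
  have s: "real s \<le> real n - Y + g + 2 * real k" "real s > real n - Y + g + 2 * real k - 1"
    using Y g unfolding s_def by linarith+
  have sn: "s < n" using s(1) g k Y n by simp
  have sk: "2 * k \<le> s" using s(2) g k Y by simp
  define z where "z = real (n - (s - 2 * k))"
  have z: "z = real n - real s + 2 * real k" using sn sk by (simp add: z_def)
  define a where "a = (\<Sum>i<s - 2 * k. 1 / real (n - i - 1)) - 1"
  have lnY: "ln Y = ln (real n) - 1" using n by (simp add: Y_def ln_div)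
  have "ln z - ln Y \<le> (z - Y) / Y" using Y z sn by (intro ln_diff_le) auto
  moreover have "(g - 1) / real n \<le> (Y - z) / Y"
    using z g Y s by (intro frac_le) auto
  moreover have "(z - Y) / Y = - ((Y - z) / Y)" by (simp add: diff_divide_distrib)
  moreover have "ln (real n) - ln z \<le> a + 1"
    unfolding a_def z_def using ln_le_sum_inverse[of "s - 2 * k" n] sn by simp
  ultimately have a: "(g - 1) / real n \<le> a" using lnY by linarith
  moreover have "0 < (g - 1) / real n" using g n by simp
  ultimately have a_pos: "a > 0" by linarith
  have "(\<Sum>i<s. 1 / (real (n - i - 1))\<^sup>2) / a\<^sup>2 \<le> 8\<^sup>2 * real n / (g - 1)\<^sup>2"
  proof (rule chebyshev_ratio_le[OF _ a])
    \<comment> \<open>\<open>n - s \<ge> Y - g - 2 k \<ge> n / 3 - n / 12 - n / 8 = n / 8\<close>,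
      so \<open>C = 8\<close>.\<close>
    show "(\<Sum>i<s. 1 / (real (n - i - 1))\<^sup>2) \<le> 8\<^sup>2 / real n"
      using sn s(1) Y g k by (intro sum_inverse_squares_le) auto
  qed (use g n in auto)
  hence "1 - 64 * real n / (g - 1)\<^sup>2 \<le> 1 - (\<Sum>i<s. 1 / (real (n - i - 1))\<^sup>2) / a\<^sup>2" by simp
  also have "\<dots> \<le> success_prob (iso_closure n (min_degree_family (2 * k + 1) n)) n (k * n
      + s) (circulant_strategy n k)"
    unfolding a_def using sn k a_pos by (intro success_prob_odd_ge) (auto simp: a_def)
  finally show ?thesis
    using s(1) by (intro exI[of _ "k * n + s"]) (simp add: Y_def algebra_simps)
qed

section \<open>From success probabilities to the random variable\<close>

lemma is_tau_lab_le:
  assumes "is_tau_lab F n M T" "n > 0" "\<And>S. S \<in> strategies n \<Longrightarrow> success_prob F n m S \<le> \<epsilon>"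
  shows "\<P>(x in M. T x \<le> enat m) \<le> \<epsilon>"
proof -
  have "strategies n \<noteq> {}" using circulant_strategy_in[OF assms(2)] by blast
  hence "Max (success_prob F n m ` strategies n) \<in> success_prob F n m ` strategies n"
    using finite_success_prob[OF assms(2)] by (intro Max_in) auto
  thus ?thesis using assms(1,3) by (auto simp: is_tau_lab_def)
qed

lemma is_tau_lab_ge:
  assumes "is_tau_lab F n M T" "n > 0" "S \<in> strategies n"
  shows "success_prob F n m S \<le> \<P>(x in M. T x \<le> enat m)"
  using assms finite_success_prob[OF assms(2)] by (auto simp: is_tau_lab_def intro!: Max_ge)

lemma sets_Collect_count_space:
  assumes "T \<in> M \<rightarrow>\<^sub>M count_space UNIV"
  shows "{x \<in> space M. P (T x)} \<in> sets M"
  using measurable_sets[OF assms, of "Collect P"] by (simp add: vimage_def Int_def conj_commute)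

lemma tendsto_chebyshev_ratio:
  fixes h :: "nat \<Rightarrow> real"
  assumes "filterlim (\<lambda>n. h n / sqrt (real n)) at_top sequentially"
  shows "(\<lambda>n. C * real n / (h n - 1)\<^sup>2) \<longlonglongrightarrow> 0"
proof -
  have "filterlim (\<lambda>n. -1 + h n / sqrt (real n)) at_top sequentially"
    by (rule filterlim_tendsto_add_at_top[OF tendsto_const assms])
  hence "filterlim (\<lambda>n. (h n - 1) / sqrt (real n)) at_top sequentially"
  proof (rule filterlim_at_top_mono)
    show "\<forall>\<^sub>F n in sequentially. -1 + h n / sqrt (real n) \<le> (h n - 1) / sqrt (real n)"
      using eventually_gt_at_top[of 0] by eventually_elim (simp add: diff_divide_distrib)
  qed
  hence "filterlim (\<lambda>n. ((h n - 1) / sqrt (real n))\<^sup>2) at_top sequentially"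
    by (intro filterlim_pow_at_top) auto
  hence "(\<lambda>n. C / ((h n - 1) / sqrt (real n))\<^sup>2) \<longlonglongrightarrow> 0"
    by (intro tendsto_divide_0[OF tendsto_const] filterlim_at_top_imp_at_infinity)
  thus ?thesis by (simp add: power_divide)
qed

lemma whpI:
  assumes "\<epsilon> \<longlonglongrightarrow> 0" "\<forall>\<^sub>F n in sequentially. prob_space (M n) \<and> 1 - \<epsilon> n \<le> \<P>(x in M n. P n x)"
  shows "whp M P"
  unfolding whp_def
proof (rule tendsto_sandwich)
  show "(\<lambda>n. 1 - \<epsilon> n) \<longlonglongrightarrow> 1" using tendsto_diff[OF tendsto_const assms(1), of 1] by simp
  show "\<forall>\<^sub>F n in sequentially. 1 - \<epsilon> n \<le> \<P>(x in M n. P n x)"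
    using assms(2) by (rule eventually_mono) simp
  show "\<forall>\<^sub>F n in sequentially. \<P>(x in M n. P n x) \<le> 1"
    using assms(2) by (rule eventually_mono) (simp add: prob_space.prob_le_1)
qed simp

lemma tau_even:
  assumes "1 \<le> k" "2 * k < n" and tau: "is_tau (min_degree_family (2 * k) n) n M T"
  shows "AE x in M. T x = enat (k * n)"
proof -
  let ?F = "iso_closure n (min_degree_family (2 * k) n)"
  have n: "n > 0" using assms by simp
  have tl: "is_tau_lab ?F n M T" using tau by (simp add: is_tau_def)
  interpret prob_space M using tl by (simp add: is_tau_lab_def)
  have T: "T \<in> M \<rightarrow>\<^sub>M count_space UNIV" using tl by (simp add: is_tau_lab_def)
  have ev: "{x \<in> space M. T x \<le> enat m} \<in> events" for m by (rule sets_Collect_count_space[OF T])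
  have kn: "k * n > 0" using assms by simp
  have "\<P>(x in M. T x \<le> enat (k * n)) \<ge> 1"
    using is_tau_lab_ge[OF tl n circulant_strategy_in[OF n], of "k * n" k] success_prob_even[OF
        assms(2)] by simp
  hence "\<P>(x in M. T x \<le> enat (k * n)) = 1" by (intro antisym prob_le_1)
  hence 1: "AE x in M. T x \<le> enat (k * n)" using prob_Collect_eq_1[OF ev] by simp
  \<comment> \<open>Since \<open>k * n > 0\<close>, the subtraction is genuine and the handshake
    count rules out success one round earlier.\<close>
  have "\<P>(x in M. T x \<le> enat (k * n - 1)) \<le> 0"
    using kn by (intro is_tau_lab_le[OF tl n] eq_refl success_prob_few_rounds) simp
  hence "\<P>(x in M. T x \<le> enat (k * n - 1)) = 0" by (intro antisym measure_nonneg)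
  hence 2: "AE x in M. \<not> T x \<le> enat (k * n - 1)" using prob_Collect_eq_0[OF ev] by simp
  from 1 2 show ?thesis
  proof eventually_elim
    case (elim x)
    thus ?case using kn by (cases "T x") auto
  qed
qed

lemma tau_odd_ge:
  fixes g :: real
  assumes n: "n > 0" and g: "g \<ge> 2" and tau: "is_tau (min_degree_family (2 * k + 1) n) n M T"
  shows "1 - 9 * real n / (g - 1)\<^sup>2
           \<le> \<P>(x in M. ereal ((real k + 1 - 1 / exp 1) * real n - g) \<le> ereal_of_enat (T x))"
proof -
  define r where "r = (real k + 1 - 1 / exp 1) * real n - g"
  let ?F = "iso_closure n (min_degree_family (2 * k + 1) n)"
  have tl: "is_tau_lab ?F n M T" using tau by (simp add: is_tau_def)
  interpret prob_space M using tl by (simp add: is_tau_lab_def)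
  have T: "T \<in> M \<rightarrow>\<^sub>M count_space UNIV" using tl by (simp add: is_tau_lab_def)
  have "1 - 9 * real n / (g - 1)\<^sup>2 \<le> \<P>(x in M. ereal r \<le> ereal_of_enat (T x))"
  proof (cases "r \<le> 0")
    case True
    have "ereal r \<le> ereal_of_enat (T x)" for x
      using True by (cases "T x") auto
    hence "\<P>(x in M. ereal r \<le> ereal_of_enat (T x)) = 1" by (simp add: prob_space)
    thus ?thesis by simp
  next
    case False
    \<comment> \<open>The largest integer strictly below \<open>r\<close>, so that not
      \<open>T x \<le> m\<close> amounts to \<open>T x \<ge> r\<close>.\<close>
    define m where "m = nat (\<lceil>r\<rceil> - 1)"
    have m: "real m < r" "r \<le> real m + 1" using False unfolding m_def by linarith+
    have ev: "{x \<in> space M. T x \<le> enat m} \<in> events" by (rule sets_Collect_count_space[OF T])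
    have "\<P>(x in M. T x \<le> enat m) \<le> 9 * real n / (g - 1)\<^sup>2"
      using m(1) by (intro is_tau_lab_le[OF tl n] success_prob_odd_early g n) (simp add: r_def)
    hence "1 - 9 * real n / (g - 1)\<^sup>2 \<le> prob (space M - {x \<in> space M. T x \<le> enat m})"
      by (simp add: prob_compl[OF ev])
    also have "\<dots> \<le> \<P>(x in M. ereal r \<le> ereal_of_enat (T x))"
    proof (rule finite_measure_mono)
      show "space M - {x \<in> space M. T x \<le> enat m} \<subseteq> {x \<in> space M. ereal r \<le> ereal_of_enat (T x)}"
      proof safe
        fix x assume "\<not> T x \<le> enat m"
        thus "ereal r \<le> ereal_of_enat (T x)" using m(2) by (cases "T x") auto
      qed
      show "{x \<in> space M. ereal r \<le> ereal_of_enat (T x)} \<in> events"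
        by (rule sets_Collect_count_space[OF T])
    qed
    finally show ?thesis .
  qed
  thus ?thesis by (simp add: r_def)
qed

text \<open>The window \<open>g\<close> of the estimate and the claimed slack \<open>h\<close> are
  kept apart, so that \<open>g\<close> can be truncated when \<open>h\<close> is large.\<close>

lemma tau_odd_le:
  fixes g h :: real
  assumes g: "2 \<le> g" "g \<le> real n / 12" "g \<le> h" and k: "2 * k + 1 < n" "real (2 * k) \<le> real n / 8"
    and tau: "is_tau (min_degree_family (2 * k + 1) n) n M T"
  shows "1 - 64 * real n / (g - 1)\<^sup>2
           \<le> \<P>(x in M. ereal_of_enat (T x)
               \<le> ereal ((real k + 1 - 1 / exp 1) * real n + h + 2 * real k))"
proof -
  let ?F = "iso_closure n (min_degree_family (2 * k + 1) n)"
  let ?r = "(real k + 1 - 1 / exp 1) * real n + h + 2 * real k"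
  have n: "n > 0" using k by simp
  have tl: "is_tau_lab ?F n M T" using tau by (simp add: is_tau_def)
  interpret prob_space M using tl by (simp add: is_tau_lab_def)
  have T: "T \<in> M \<rightarrow>\<^sub>M count_space UNIV" using tl by (simp add: is_tau_lab_def)
  obtain m where m: "real m \<le> (real k + 1 - 1 / exp 1) * real n + g + 2 * real k"
    "1 - 64 * real n / (g - 1)\<^sup>2 \<le> success_prob ?F n m (circulant_strategy n k)"
    using success_prob_odd_late[OF g(1,2) k] by blast
  note m(2)
  also have "success_prob ?F n m (circulant_strategy n k) \<le> \<P>(x in M. T x \<le> enat m)"
    by (rule is_tau_lab_ge[OF tl n circulant_strategy_in[OF n]])
  also have "\<dots> \<le> \<P>(x in M. ereal_of_enat (T x) \<le> ereal ?r)"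
  proof (rule finite_measure_mono)
    have "real m \<le> ?r" using m(1) g(3) by simp
    thus "{x \<in> space M. T x \<le> enat m} \<subseteq> {x \<in> space M. ereal_of_enat (T x) \<le> ereal ?r}"
    proof safe
      fix x assume "T x \<le> enat m" "real m \<le> ?r"
      thus "ereal_of_enat (T x) \<le> ereal ?r" by (cases "T x") auto
    qed
    show "{x \<in> space M. ereal_of_enat (T x) \<le> ereal ?r} \<in> events"
      by (rule sets_Collect_count_space[OF T])
  qed
  finally show ?thesis .
qed

theorem theorem5p1:
  fixes f :: "nat \<Rightarrow> nat"
  assumes f: "(\<lambda>n. real (f n)) \<in> \<omega>(\<lambda>n. sqrt (real n))"
  shows
    "(\<forall>(n::nat) (d::nat) (k::nat) (M :: 'a measure) T.
        1 \<le> d \<and> d \<le> n - 1 \<and> even d \<and> k = d div 2 \<and>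
        is_tau (min_degree_family d n) n M T \<longrightarrow>
        (AE x in M. T x = enat (k * n))) \<and>
     (\<forall>(d :: nat \<Rightarrow> nat) (k :: nat \<Rightarrow> nat) (M :: nat \<Rightarrow> 'a measure) T.
        (\<forall>\<^sub>F n in sequentially.
           1 \<le> d n \<and> d n \<le> n - 1 \<and> odd (d n) \<and> k n = (d n - 1) div 2 \<and>
           is_tau (min_degree_family (d n) n) n (M n) (T n)) \<longrightarrow>
        whp M (\<lambda>n x. ereal ((real (k n) + 1 - 1 / exp 1) * real n - real (f n))
                        \<le> ereal_of_enat (T n x)) \<and>
        ((\<lambda>n. real (d n)) \<in> o(\<lambda>n. real n) \<longrightarrow>
         whp M (\<lambda>n x. ereal ((real (k n) + 1 - 1 / exp 1) * real n - real (f n))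
                        \<le> ereal_of_enat (T n x) \<and>
                       ereal_of_enat (T n x)
                        \<le> ereal ((real (k n) + 1 - 1 / exp 1) * real n + real (f n)
                                   + 2 * real (k n)))))"
proof -
  have lim: "filterlim (\<lambda>n. real (f n) / sqrt (real n)) at_top sequentially"
  proof -
    have "\<forall>\<^sub>F n in sequentially. sqrt (real n) \<noteq> 0"
      using eventually_gt_at_top[of 0] by eventually_elim simp
    from smallomegaD_filterlim_at_top_norm[OF f this] show ?thesis by simp
  qed
  have large: "\<forall>\<^sub>F n in sequentially. n > 0 \<and> real (f n) \<ge> 2"
    using lim[unfolded filterlim_at_top, rule_format, of 2] eventually_gt_at_top[of 0]
  proof eventually_elim
    case (elim n)
    have "2 * sqrt (real n) \<le> real (f n)" using elim by (simp add: field_simps)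
    moreover have "sqrt (real n) \<ge> 1" using elim by simp
    ultimately have "real (f n) \<ge> 2" by linarith
    thus ?case using elim by simp
  qed
  show ?thesis
  proof (intro conjI allI impI, goal_cases)
    case (1 n d k M T)
    hence "d = 2 * k" "1 \<le> k" by auto
    with 1 show ?case by (intro tau_even) auto
  next
    case (2 d k M T)
    show ?case
    proof (rule whpI[OF tendsto_chebyshev_ratio[OF lim, of 9]])
      from 2 large show "\<forall>\<^sub>F n in sequentially. prob_space (M n)
          \<and> 1 - 9 * real n / (real (f n) - 1)\<^sup>2
        \<le> \<P>(x in M n. ereal ((real (k n) + 1 - 1 / exp 1) * real n - real (f n))
            \<le> ereal_of_enat (T n x))"
      proof eventually_elim
        case (elim n)
        have "d n = 2 * k n + 1" using elim by auto
        with elim have tau: "is_tau (min_degree_family (2 * k n + 1) n) n (M n) (T n)" by simp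
        hence "prob_space (M n)" by (simp add: is_tau_def is_tau_lab_def)
        thus ?case using tau_odd_ge[OF _ _ tau, of "real (f n)"] elim by simp
      qed
    qed
  next
    case (3 d k M T)
    \<comment> \<open>\<open>f n\<close> may exceed \<open>n / 12\<close>. The minimum still
      outgrows \<open>sqrt n\<close>, and a smaller window only strengthens the bound.\<close>
    define g where "g n = min (real (f n)) (real n / 12)" for n
    let ?A = "\<lambda>n x. ereal ((real (k n) + 1 - 1 / exp 1) * real n - real (f n))
        \<le> ereal_of_enat (T n x)"
    let ?B = "\<lambda>n x. ereal_of_enat (T n x)
        \<le> ereal ((real (k n) + 1 - 1 / exp 1) * real n + real (f n) + 2 * real (k n))"
    have lim': "filterlim (\<lambda>n. g n / sqrt (real n)) at_top sequentially"
      unfolding filterlim_at_top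
    proof
      fix Z :: real
      have "filterlim (\<lambda>n. (1 / 12) * sqrt (real n)) at_top sequentially"
        by (intro filterlim_tendsto_pos_mult_at_top[OF tendsto_const]
              filterlim_compose[OF sqrt_at_top filterlim_real_sequentially]) simp
      hence "\<forall>\<^sub>F n in sequentially. Z \<le> (1 / 12) * sqrt (real n)" by (simp add: filterlim_at_top)
      moreover have "\<forall>\<^sub>F n in sequentially. Z \<le> real (f n) / sqrt (real n)"
        using lim by (simp add: filterlim_at_top)
      ultimately show "\<forall>\<^sub>F n in sequentially. Z \<le> g n / sqrt (real n)"
      proof eventually_elim
        case (elim n)
        have "(1 / 12) * sqrt (real n) = (real n / 12) / sqrt (real n)"
          using real_div_sqrt[of "real n"] by (simp add: field_simps)
        with elim show ?case by (simp add: g_def min_def)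
      qed
    qed
    have small: "\<forall>\<^sub>F n in sequentially. real (d n) \<le> 1 / 8 * real n"
      using landau_o.smallD[OF 3(2), of "1 / 8"] by simp
    have "(\<lambda>n. 9 * real n / (real (f n) - 1)\<^sup>2 + 64 * real n / (g n - 1)\<^sup>2) \<longlonglongrightarrow> 0 + 0"
      by (intro tendsto_add tendsto_chebyshev_ratio lim lim')
    hence \<epsilon>: "(\<lambda>n. 9 * real n / (real (f n) - 1)\<^sup>2 + 64 * real n / (g n - 1)\<^sup>2) \<longlonglongrightarrow> 0" by simp
    show ?case
    proof (rule whpI[OF \<epsilon>])
      \<comment> \<open>\<open>n \<ge> 24\<close> ensures \<open>n / 12 \<ge> 2\<close>, hence
        \<open>g n \<ge> 2\<close>.\<close>
      from 3(1) large small eventually_ge_at_top[of 24]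
      show "\<forall>\<^sub>F n in sequentially. prob_space (M n) \<and>
        1 - (9 * real n / (real (f n) - 1)\<^sup>2 + 64 * real n / (g n - 1)\<^sup>2)
            \<le> \<P>(x in M n. ?A n x \<and> ?B n x)"
      proof eventually_elim
        case (elim n)
        have d: "d n = 2 * k n + 1" using elim by auto
        with elim have tau: "is_tau (min_degree_family (2 * k n + 1) n) n (M n) (T n)" by simp
        interpret prob_space "M n" using tau by (simp add: is_tau_def is_tau_lab_def)
        have T: "T n \<in> M n \<rightarrow>\<^sub>M count_space UNIV" using tau by (simp add: is_tau_def is_tau_lab_def)
        have ev: "{x \<in> space (M n). ?A n x} \<in> events" "{x \<in> space (M n). ?B n x} \<in> events"
          by (rule sets_Collect_count_space[OF T])+
        have A: "1 - 9 * real n / (real (f n) - 1)\<^sup>2 \<le> \<P>(x in M n. ?A n x)"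
          using tau_odd_ge[OF _ _ tau, of "real (f n)"] elim by simp
        have B: "1 - 64 * real n / (g n - 1)\<^sup>2 \<le> \<P>(x in M n. ?B n x)"
          using elim d by (intro tau_odd_le[OF _ _ _ _ _ tau]) (auto simp: g_def)
        have "\<P>(x in M n. ?A n x) + \<P>(x in M n. ?B n x)
            = prob ({x \<in> space (M n). ?A n x} \<union> {x \<in> space (M n). ?B n x})
              + prob ({x \<in> space (M n). ?A n x} \<inter> {x \<in> space (M n). ?B n x})"
          using measure_Un3[of "{x \<in> space (M n). ?A n x}" "M n" "{x \<in> space (M n). ?B n x}"] ev
          by (simp add: fmeasurable_eq_sets)
        also have "\<dots> \<le> 1 + prob ({x \<in> space (M n). ?A n x} \<inter> {x \<in> space (M n). ?B n x})"
          by simp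
        also have "{x \<in> space (M n). ?A n x} \<inter> {x \<in> space (M n). ?B n x} = {x \<in> space (M n). ?A n x
            \<and> ?B n x}"
          by blast
        finally show ?case using A B prob_space_axioms by linarith
      qed
    qed
  qed
qed

end
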